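(* Let $\alpha>0$ and let $\{(X_i,Y_i)\}_{i\ge1}$ be independent and identically distributed random vectors whose generic vector $(X,Y)$ follows a bivariate Sarmanov distribution with marginal distribution functions $F$ (of $X$) and $G$ (of $Y$), kernels $\phi_1,\phi_2$ and parameter $\theta\in\mathbb{R}$, with $X\in RV_{-\alpha}$; write $\overline F(x)=P[X>x]=x^{-\alpha}L(x)$ with $L$ slowly varying. Suppose $E[Y^\alpha]<\infty$, $P[Y>x]=o(P[X>x])$ as $x\to\infty$, and $\lim_{x\to\infty}\phi_1(x)=d_1$ (in $\mathbb{R}$). For $n\ge1$ let $$\Psi(x,n)=P\left[\max_{1\le k\le n}\sum_{i=1}^{k}X_i\prod_{j=1}^{i}Y_j>x\right].$$ If any one of the conditions (DZ2), (DZ3), (DZ4) (see context) holds for $(X,Y)$, then for every $n\geq 1$, as $x\to\infty$, $$\Psi(x,n)\sim\frac{(1-E[Y^\alpha]^n)\,\{E[Y^\alpha]+\theta d_1E[\phi_2(Y)Y^\alpha]\}}{1-E[Y^\alpha]}\,\overline F(x),$$ with the convention that $(1-E[Y^\alpha]^n)/(1-E[Y^\alpha])=n$ when $E[Y^\alpha]=1$. (Here $E[Y^\alpha]^n$ denotes $(E[Y^\alpha])^n$.)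
   Context: Asymptotics: $a(x)\sim b(x)$ means $a(x)/b(x)\to1$ as $x\to\infty$. Regular variation: $X\in RV_{-\alpha}$ means $\overline F(xy)\sim y^{-\alpha}\overline F(x)$ as $x\to\infty$ for every $y>0$, where $\overline F(x)=P[X>x]$. Bivariate Sarmanov distribution: $(X,Y)$ with $X$ real valued and $Y\ge 0$ follows a bivariate Sarmanov distribution if $P(X\in dx,Y\in dy)=(1+\theta\phi_1(x)\phi_2(y))F(dx)G(dy)$, $x\in\mathbb{R}$, $y\ge0$, where $F,G$ are the marginal distributions of $X,Y$, the kernels $\phi_1,\phi_2$ are real-valued functions and $\theta$ is a real constant such that $E\{\phi_1(X)\}=E\{\phi_2(Y)\}=0$ and $1+\theta\phi_1(x)\phi_2(y)\ge0$ for all $x\in D_X$, $y\in D_Y$, where $D_X\subset\mathbb{R}$ and $D_Y\subset\mathbb{R}^+$ are the supports of $X$ and $Y$. Long-tailed: a random variable $U$ is long tailed if $P[U>x]\sim P[U>x+y]$ as $x\to\infty$ for any $y$. Class $\mathcal S_d$: a nonnegative function $f$ is in $\mathcal S_d$ if $\lim_{x\to\infty}\int_0^x \frac{f(x-y)}{f(x)}f(y)\,dy=2\int_0^\infty f(u)\,du<\infty$. Write $U\in\mathcal S^*$ if $f(x)=P[U>x]$ is in $\mathcal S_d$. Types of $L(x)=x^{\alpha}\overline F(x)$: $L$ is of type (iii) if $L(x)=c(x)P(U>\log x)$, and of type (iv) if $L(x)=c(x)P(U>\log x)/P(V>\log x)$, where $U,V$ are long-tailed random variables and $\lim_{x\to\infty}c(x)=c\in(0,\infty)$.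 The conditions: (DZ2) $L$ is of type (iii) or (iv), and the function $x\mapsto L(e^x)$ is in $\mathcal S_d$. (DZ3) $L$ is of type (iii) or (iv), $U\in\mathcal S^*$ (with $U$ from that representation), and $P(Y>x)=o(x^{-\alpha}P[U>\log x])$. (DZ4) $m(x):=\int_0^x v^\alpha F(dv)\to\infty$ as $x\to\infty$ (infinite $\alpha$-th moment of $X$); moreover $P(Y>x)=o(P[X>x]/m(x))$ and $\limsup_{x\to\infty}\sup_{\sqrt x\le y\le x}L(y)/L(x)<\infty$. *)

theory Defs
  imports "HOL-Probability.Probability" "HOL-Library.Landau_Symbols"
begin

text \<open>Random variables occurring only through their law (in particular \<open>U\<close> and \<open>V\<close> below)
  are represented by that law, a probability measure on the Borel sets of the reals.\<close>

definition tail :: "real measure \<Rightarrow> real \<Rightarrow> real" where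
  "tail \<mu> x = measure \<mu> {x<..}"

text \<open>Not the library's asymptotic equivalence, which also relates two functions that are both
  eventually zero. As \<open>a / 0 = 0\<close>, the limit below forces both functions to be eventually nonzero.\<close>

definition tail_equiv :: "(real \<Rightarrow> real) \<Rightarrow> (real \<Rightarrow> real) \<Rightarrow> bool" where
  "tail_equiv a b \<longleftrightarrow> ((\<lambda>x. a x / b x) \<longlongrightarrow> 1) at_top"

definition regularly_varying_tail :: "real \<Rightarrow> real measure \<Rightarrow> bool" where
  "regularly_varying_tail \<alpha> F \<longleftrightarrow>
     (\<forall>y>0. tail_equiv (\<lambda>x. tail F (x * y)) (\<lambda>x. y powr (-\<alpha>) * tail F x))"

definition long_tailed :: "real measure \<Rightarrow> bool" where
  "long_tailed \<mu> \<longleftrightarrow> (\<forall>y. tail_equiv (tail \<mu>) (\<lambda>x. tail \<mu> (x + y)))"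

definition law_support :: "real measure \<Rightarrow> real set" where
  "law_support \<mu> = {x. \<forall>e>0. measure \<mu> (ball x e) > 0}"

definition sarmanov ::
  "'a measure \<Rightarrow> ('a \<Rightarrow> real) \<Rightarrow> ('a \<Rightarrow> real) \<Rightarrow> real measure \<Rightarrow> real measure \<Rightarrow>
   (real \<Rightarrow> real) \<Rightarrow> (real \<Rightarrow> real) \<Rightarrow> real \<Rightarrow> bool" where
  "sarmanov M X Y F G \<phi>\<^sub>1 \<phi>\<^sub>2 \<theta> \<longleftrightarrow>
     X \<in> borel_measurable M \<and> Y \<in> borel_measurable M \<and> (AE \<omega> in M. Y \<omega> \<ge> 0) \<and>
     F = distr M borel X \<and> G = distr M borel Y \<and>
     \<phi>\<^sub>1 \<in> borel_measurable borel \<and> \<phi>\<^sub>2 \<in> borel_measurable borel \<and>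
     integrable M (\<lambda>\<omega>. \<phi>\<^sub>1 (X \<omega>)) \<and> (\<integral>\<omega>. \<phi>\<^sub>1 (X \<omega>) \<partial>M) = 0 \<and>
     integrable M (\<lambda>\<omega>. \<phi>\<^sub>2 (Y \<omega>)) \<and> (\<integral>\<omega>. \<phi>\<^sub>2 (Y \<omega>) \<partial>M) = 0 \<and>
     (\<forall>x\<in>law_support F. \<forall>y\<in>law_support G. 1 + \<theta> * \<phi>\<^sub>1 x * \<phi>\<^sub>2 y \<ge> 0) \<and>
     distr M (borel \<Otimes>\<^sub>M borel) (\<lambda>\<omega>. (X \<omega>, Y \<omega>)) =
       density (F \<Otimes>\<^sub>M G) (\<lambda>(x, y). ennreal (1 + \<theta> * \<phi>\<^sub>1 x * \<phi>\<^sub>2 y))"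

text \<open>The condition that \<open>f\<close> is eventually positive is implicit in the quotient; without it,
  the convention \<open>a / 0 = 0\<close> would admit functions vanishing almost everywhere.
  The function only matters on the nonnegative half-line.\<close>

definition class_Sd :: "(real \<Rightarrow> real) \<Rightarrow> bool" where
  "class_Sd f \<longleftrightarrow>
     set_borel_measurable borel {0..} f \<and> (\<forall>x\<ge>0. f x \<ge> 0) \<and> (\<forall>\<^sub>F x in at_top. f x > 0) \<and>
     (\<integral>\<^sup>+u\<in>{0..}. ennreal (f u) \<partial>lborel) < \<infinity> \<and>
     ((\<lambda>x. \<integral>\<^sup>+y\<in>{0..x}. ennreal (f (x - y) / f x * f y) \<partial>lborel)
        \<longlongrightarrow> 2 * (\<integral>\<^sup>+u\<in>{0..}. ennreal (f u) \<partial>lborel)) at_top"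

definition class_S_star :: "real measure \<Rightarrow> bool" where
  "class_S_star \<mu> \<longleftrightarrow> class_Sd (tail \<mu>)"

definition slow_part :: "real \<Rightarrow> real measure \<Rightarrow> real \<Rightarrow> real" where
  "slow_part \<alpha> F x = x powr \<alpha> * tail F x"

definition type_iii :: "(real \<Rightarrow> real) \<Rightarrow> real measure \<Rightarrow> bool" where
  "type_iii L U \<longleftrightarrow> real_distribution U \<and> long_tailed U \<and>
     (\<exists>c c\<^sub>0. 0 < c\<^sub>0 \<and> (c \<longlongrightarrow> c\<^sub>0) at_top \<and> (\<forall>x>0. L x = c x * tail U (ln x)))"

definition type_iv :: "(real \<Rightarrow> real) \<Rightarrow> real measure \<Rightarrow> real measure \<Rightarrow> bool" where
  "type_iv L U V \<longleftrightarrow>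
     real_distribution U \<and> long_tailed U \<and> real_distribution V \<and> long_tailed V \<and>
     (\<exists>c c\<^sub>0. 0 < c\<^sub>0 \<and> (c \<longlongrightarrow> c\<^sub>0) at_top \<and>
        (\<forall>x>0. L x = c x * (tail U (ln x) / tail V (ln x))))"

definition DZ2 :: "real \<Rightarrow> real measure \<Rightarrow> bool" where
  "DZ2 \<alpha> F \<longleftrightarrow>
     (\<exists>U. type_iii (slow_part \<alpha> F) U \<or> (\<exists>V. type_iv (slow_part \<alpha> F) U V)) \<and>
     class_Sd (\<lambda>x. slow_part \<alpha> F (exp x))"

definition DZ3 :: "real \<Rightarrow> real measure \<Rightarrow> real measure \<Rightarrow> bool" where
  "DZ3 \<alpha> F G \<longleftrightarrow>
     (\<exists>U. (type_iii (slow_part \<alpha> F) U \<or> (\<exists>V. type_iv (slow_part \<alpha> F) U V)) \<and>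
          class_S_star U \<and> tail G \<in> o[at_top](\<lambda>x. x powr (-\<alpha>) * tail U (ln x)))"

definition truncated_moment :: "real \<Rightarrow> real measure \<Rightarrow> real \<Rightarrow> real" where
  "truncated_moment \<alpha> F x = (LINT v:{0..x}|F. v powr \<alpha>)"

definition DZ4 :: "real \<Rightarrow> real measure \<Rightarrow> real measure \<Rightarrow> bool" where
  "DZ4 \<alpha> F G \<longleftrightarrow>
     filterlim (truncated_moment \<alpha> F) at_top at_top \<and>
     tail G \<in> o[at_top](\<lambda>x. tail F x / truncated_moment \<alpha> F x) \<and>
     Limsup at_top (\<lambda>x. SUP y\<in>{sqrt x..x}. ereal (slow_part \<alpha> F y / slow_part \<alpha> F x)) < \<infinity>"

definition ruin_prob ::
  "'a measure \<Rightarrow> (nat \<Rightarrow> 'a \<Rightarrow> real) \<Rightarrow> (nat \<Rightarrow> 'a \<Rightarrow> real) \<Rightarrow> real \<Rightarrow> nat \<Rightarrow> real" where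
  "ruin_prob M X Y x n =
     measure M {\<omega> \<in> space M. (MAX k\<in>{1..n}. \<Sum>i=1..k. X i \<omega> * (\<Prod>j=1..i. Y j \<omega>)) > x}"

definition geom_factor :: "real \<Rightarrow> nat \<Rightarrow> real" where
  "geom_factor e n = (if e = 1 then real n else (1 - e ^ n) / (1 - e))"

text \<open>\<open>a(x) \<sim> C b(x)\<close> for a constant \<open>C\<close>. When \<open>C = 0\<close>, which happens for instance if
  \<open>Y = 0\<close> almost surely, the quotient \<open>a(x) / (C b(x))\<close> is undefined and the relation has its usual
  meaning \<open>a(x) = o(b(x))\<close>.\<close>

definition equiv_const_mult :: "(real \<Rightarrow> real) \<Rightarrow> real \<Rightarrow> (real \<Rightarrow> real) \<Rightarrow> bool" where
  "equiv_const_mult a C b \<longleftrightarrow>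
     (if C = 0 then a \<in> o[at_top](b) else tail_equiv a (\<lambda>x. C * b x))"

end

theory Submission
  imports Defs
begin

text \<open>Write \<open>W\<^sub>n\<close> for the positive part of the maximum over \<open>k \<le> n\<close> of the discounted partial sums
\<open>S\<^sub>k = X\<^sub>1 Y\<^sub>1 + \<dots> + X\<^sub>k Y\<^sub>1 \<cdots> Y\<^sub>k\<close>. As \<open>Y \<ge> 0\<close>, the first factor can be pulled out:
\<open>W\<^sub>n\<close> is the positive part of \<open>Y\<^sub>1 (X\<^sub>1 + W')\<close>, where \<open>W'\<close> is built from the later pairs, hence is
independent of \<open>(X\<^sub>1, Y\<^sub>1)\<close> and distributed like \<open>W\<^bsub>n-1\<^esub>\<close>. If \<open>P(W' > x)\<close> divided by the tail of
\<open>F\<close> tends to \<open>c\<close>, then the same quotient for \<open>Y (X + W')\<close> tends to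
\<open>A + c E[Y\<^sup>\<alpha>]\<close> with \<open>A = E[Y\<^sup>\<alpha>] + \<theta> d\<^sub>1 E[\<phi>\<^sub>2(Y) Y\<^sup>\<alpha>]\<close>. Iterating from \<open>c = 0\<close> gives the geometric sum
\<open>A (1 + E[Y\<^sup>\<alpha>] + \<dots> + E[Y\<^sup>\<alpha>]\<^bsup>n-1\<^esup>)\<close>.

The single step (\<open>randomly_discounted_sum_tail\<close>) conditions on \<open>Y = y\<close>. The law of \<open>X\<close> then has density
\<open>1 + \<theta> \<phi>\<^sub>1(u) \<phi>\<^sub>2(y)\<close> with respect to \<open>F\<close>, and since \<open>\<phi>\<^sub>1\<close> tends to \<open>d\<^sub>1\<close>, its tail is asymptotic to
\<open>1 + \<theta> d\<^sub>1 \<phi>\<^sub>2(y)\<close> times that of \<open>F\<close>. By the single big jump principle (\<open>convolution_tail_limit\<close>) adding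
the independent \<open>W'\<close> adds \<open>c\<close> to this factor, and replacing the threshold \<open>x\<close> by \<open>x / y\<close> multiplies by
\<open>y\<^sup>\<alpha>\<close>. It remains to integrate the limit over \<open>G\<close>. Both kernels of a Sarmanov law are bounded on
the supports (\<open>kernel_bounded\<close>) unless the coupling is trivial, so that the integrands are dominated by a
multiple of \<open>tail F (x / y) / tail F x\<close>, which is the integrand of Breiman's theorem for independent factors.

For \<open>y\<close> in a bounded set, regular variation bounds that integrand by a constant. The contribution of large
\<open>y\<close> is where the three conditions enter (\<open>large_factor_negligible\<close>). The values \<open>y > x\<close> are harmless because
the tail of \<open>G\<close> is negligible against that of \<open>F\<close>. On the logarithmic scale the rest is at most a
constant times the integral over \<open>s\<close> of \<open>tail F (x / e\<^sup>s) tail G (e\<^sup>s)\<close>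
(\<open>product_tail_le_log_convolution\<close>). Under the first two conditions this is a small multiple of \<open>x\<^sup>-\<^sup>\<alpha>\<close> times the
convolution, evaluated at \<open>log x\<close>, of \<open>L(e\<^sup>s)\<close> with \<open>L(e\<^sup>s)\<close> itself or with the tail of \<open>U\<close>, which
subexponentiality compares with \<open>L(x)\<close>. Under the third condition, \<open>L(x / y)\<close> is at most a constant times
\<open>L(x)\<close> for \<open>y \<le> \<surd>x\<close>, while for larger \<open>y\<close> the integral of \<open>L\<close> that appears is compensated by the truncated
moment in the bound on the tail of \<open>G\<close>.\<close>

section \<open>Tails and regular variation\<close>

lemma tail_nonneg [simp]: "0 \<le> tail \<mu> x"
  by (simp add: tail_def)

lemma tail_le_1: "real_distribution \<mu> \<Longrightarrow> tail \<mu> x \<le> 1"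
  unfolding tail_def real_distribution_def using prob_space.prob_le_1 by blast

lemma tail_antimono:
  assumes "real_distribution \<mu>" "x \<le> y"
  shows "tail \<mu> y \<le> tail \<mu> x"
proof -
  interpret real_distribution \<mu> by fact
  show ?thesis unfolding tail_def using assms(2) by (intro finite_measure_mono) auto
qed

lemma tail_measurable [measurable (raw)]:
  assumes "real_distribution \<mu>" "f \<in> borel_measurable N"
  shows "(\<lambda>x. tail \<mu> (f x)) \<in> borel_measurable N"
proof -
  have "mono (\<lambda>x. - tail \<mu> x)"
    using tail_antimono[OF assms(1)] by (simp add: mono_def)
  then have "(\<lambda>x. - (- tail \<mu> x)) \<in> borel_measurable borel"
    by (intro borel_measurable_uminus borel_measurable_mono)
  then have "tail \<mu> \<in> borel_measurable borel" by simp
  from measurable_compose[OF assms(2) this] show ?thesis .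
qed

text \<open>Monotonicity spreads positivity backwards: a tail that vanishes somewhere vanishes from there on.\<close>
lemma tail_pos_if_eventually_nonzero:
  assumes "real_distribution \<mu>" "\<forall>\<^sub>F x in at_top. tail \<mu> x \<noteq> 0"
  shows "0 < tail \<mu> x"
proof -
  from assms(2) obtain z where "\<And>y. y \<ge> z \<Longrightarrow> tail \<mu> y \<noteq> 0"
    by (auto simp: eventually_at_top_linorder)
  then have "tail \<mu> (max x z) \<noteq> 0" by simp
  then have "0 < tail \<mu> (max x z)" using tail_nonneg[of \<mu>] by (metis less_eq_real_def)
  also have "\<dots> \<le> tail \<mu> x" by (rule tail_antimono[OF assms(1)]) simp
  finally show ?thesis .
qed

lemma long_tailed_pos:
  assumes "real_distribution \<mu>" "long_tailed \<mu>"
  shows "0 < tail \<mu> x"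
proof (rule tail_pos_if_eventually_nonzero[OF assms(1)])
  have "((\<lambda>x. tail \<mu> x / tail \<mu> (x + 0)) \<longlongrightarrow> 1) at_top"
    using assms(2) unfolding long_tailed_def tail_equiv_def by blast
  then have "\<forall>\<^sub>F x in at_top. tail \<mu> x / tail \<mu> (x + 0) > 1/2"
    by (rule order_tendstoD) simp
  then show "\<forall>\<^sub>F x in at_top. tail \<mu> x \<noteq> 0" by eventually_elim auto
qed

locale regularly_varying = real_distribution F for F :: "real measure" +
  fixes \<alpha> :: real
  assumes index_pos: "\<alpha> > 0" and rv: "regularly_varying_tail \<alpha> F"
begin

lemma dist_F: "real_distribution F" by unfold_locales

lemmas F_le_1 = tail_le_1[OF dist_F] and F_antimono = tail_antimono[OF dist_F]

lemma F_pos: "0 < tail F x"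
proof (rule tail_pos_if_eventually_nonzero[OF dist_F])
  have "((\<lambda>x. tail F (x * 1) / (1 powr (-\<alpha>) * tail F x)) \<longlongrightarrow> 1) at_top"
    using rv unfolding regularly_varying_tail_def tail_equiv_def using zero_less_one by blast
  then have "\<forall>\<^sub>F x in at_top. tail F (x * 1) / (1 powr (-\<alpha>) * tail F x) > 1/2"
    by (rule order_tendstoD) simp
  then show "\<forall>\<^sub>F x in at_top. tail F x \<noteq> 0" by eventually_elim auto
qed

lemma ratio_limit:
  assumes "y > 0"
  shows "((\<lambda>x. tail F (x * y) / tail F x) \<longlongrightarrow> y powr (-\<alpha>)) at_top"
proof -
  have "((\<lambda>x. tail F (x * y) / (y powr (-\<alpha>) * tail F x)) \<longlongrightarrow> 1) at_top"
    using rv assms unfolding regularly_varying_tail_def tail_equiv_def by blast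
  from tendsto_mult_left[OF this, of "y powr (-\<alpha>)"] show ?thesis
    using assms by (simp add: field_simps)
qed

lemma ratio_limit_div:
  assumes "y > 0"
  shows "((\<lambda>x. tail F (x / y) / tail F x) \<longlongrightarrow> y powr \<alpha>) at_top"
  using ratio_limit[of "inverse y"] assms
  by (simp add: divide_inverse inverse_powr powr_minus)

text \<open>Regular variation gives this for large \<open>t\<close>; on the remaining bounded range the right-hand side is bounded
away from zero. Uniformity in \<open>t\<close> is what later lets the threshold be moved by a factor \<open>e\<close> freely.\<close>
lemma dilation_bound:
  obtains C where "C \<ge> 1" "\<And>t. t \<ge> 0 \<Longrightarrow> tail F t \<le> C * tail F (exp 1 * t)"
proof -
  have "((\<lambda>x. tail F (x * exp 1) / tail F x) \<longlongrightarrow> exp 1 powr (-\<alpha>)) at_top"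
    by (rule ratio_limit) simp
  then have "\<forall>\<^sub>F x in at_top. tail F (x * exp 1) / tail F x > exp 1 powr (-\<alpha>) / 2"
    by (rule order_tendstoD) simp
  then obtain z where z: "\<And>x. x \<ge> z \<Longrightarrow> tail F (x * exp 1) / tail F x > exp 1 powr (-\<alpha>) / 2"
    by (auto simp: eventually_at_top_linorder)
  define C where "C = max 1 (max (2 * exp 1 powr \<alpha>) (1 / tail F (exp 1 * z)))"
  show ?thesis
  proof (rule that[of C])
    fix t :: real assume t: "t \<ge> 0"
    show "tail F t \<le> C * tail F (exp 1 * t)"
    proof (cases "t \<ge> z")
      case True
      have "tail F t \<le> 2 * exp 1 powr \<alpha> * tail F (exp 1 * t)"
        using z[OF True] F_pos[of t] by (simp add: field_simps powr_minus)
      also have "\<dots> \<le> C * tail F (exp 1 * t)"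
        by (intro mult_right_mono) (auto simp: C_def)
      finally show ?thesis .
    next
      case False
      have "tail F t \<le> 1 / tail F (exp 1 * z) * tail F (exp 1 * z)"
        using F_le_1 F_pos[of "exp 1 * z"] by simp
      also have "\<dots> \<le> 1 / tail F (exp 1 * z) * tail F (exp 1 * t)"
        using False t by (intro mult_left_mono F_antimono) auto
      also have "\<dots> \<le> C * tail F (exp 1 * t)"
        by (intro mult_right_mono) (auto simp: C_def)
      finally show ?thesis .
    qed
  qed (simp add: C_def)
qed

lemma slow_part_pos: "x > 0 \<Longrightarrow> 0 < slow_part \<alpha> F x"
  using F_pos by (simp add: slow_part_def)

lemma slow_part_measurable [measurable]: "slow_part \<alpha> F \<in> borel_measurable borel"
  unfolding slow_part_def using dist_F by measurable

end

section \<open>Large factors are negligible\<close>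

text \<open>With \<open>X\<close> and \<open>Y\<close> independent, the integral is \<open>P(X Y > x, Y > K)\<close>. This is the part of Breiman's theorem that
regular variation of \<open>F\<close> and a finite \<open>\<alpha>\<close>-th moment of \<open>G\<close> do not yield on their own.\<close>
definition large_factor_negligible :: "real measure \<Rightarrow> real measure \<Rightarrow> bool" where
  "large_factor_negligible F G \<longleftrightarrow>
     (\<forall>\<epsilon>>0. \<exists>K>0. \<forall>\<^sub>F x in at_top.
        (\<integral>\<^sup>+y\<in>{K<..}. ennreal (tail F (x / y)) \<partial>G) \<le> ennreal (\<epsilon> * tail F x))"

context regularly_varying
begin

text \<open>The measure \<open>G\<close> may have atoms, so its integral is first smeared out: each value \<open>y\<close> is replaced by the
interval of length one of those \<open>s\<close> with \<open>e\<^sup>s < y \<le> e\<^bsup>s+1\<^esup>\<close>, on which \<open>tail F (x / y)\<close> and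
\<open>tail F (x / e\<^sup>s)\<close> are comparable by the dilation bound. Exchanging the integrals then turns \<open>G\<close> into its tail.
Smearing downwards, as here, keeps the upper limit at \<open>ln B\<close>, so that \<open>B = x\<close> gives an integral over a part of
\<open>[0, ln x]\<close>.\<close>
lemma product_tail_le_log_convolution:
  assumes G: "real_distribution G" and "A > 0" "x > 0" "C \<ge> 0"
    and C: "\<And>t. t \<ge> 0 \<Longrightarrow> tail F t \<le> C * tail F (exp 1 * t)"
  shows "(\<integral>\<^sup>+y\<in>{A<..B}. ennreal (tail F (x / y)) \<partial>G) \<le>
    ennreal C * (\<integral>\<^sup>+s\<in>{ln A - 1..ln B}. ennreal (tail F (x / exp s) * tail G (exp s)) \<partial>lborel)"
proof -
  interpret G: real_distribution G by fact
  interpret pair_sigma_finite G lborel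
    by unfold_locales
  note [measurable] = dist_F G
  define k where "k = (\<lambda>y s. ennreal C * ennreal (tail F (x / exp s)) * indicator {A<..B} y * indicator {ln y - 1..<ln y} s)"
  have k_meas[measurable]: "(\<lambda>p. k (fst p) (snd p)) \<in> borel_measurable (G \<Otimes>\<^sub>M lborel)"
    unfolding k_def indicator_def atLeastLessThan_iff greaterThanAtMost_iff
    by measurable
  have k_meas'[measurable]: "(\<lambda>(y, s). k y s) \<in> borel_measurable (G \<Otimes>\<^sub>M lborel)"
    using k_meas by (simp add: case_prod_beta)
  have "(\<integral>\<^sup>+y\<in>{A<..B}. ennreal (tail F (x / y)) \<partial>G) \<le> (\<integral>\<^sup>+y. (\<integral>\<^sup>+s. k y s \<partial>lborel) \<partial>G)"
  proof (rule nn_integral_mono)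
    fix y assume "y \<in> space G"
    show "ennreal (tail F (x / y)) * indicator {A<..B} y \<le> (\<integral>\<^sup>+s. k y s \<partial>lborel)"
    proof (cases "y \<in> {A<..B}")
      case True
      with \<open>A > 0\<close> have y: "y > 0" by simp
      have "ennreal (tail F (x / y)) = (\<integral>\<^sup>+s. ennreal (tail F (x / y)) * indicator {ln y - 1..<ln y} s \<partial>lborel)"
        by (simp add: nn_integral_cmult)
      also have "\<dots> \<le> (\<integral>\<^sup>+s. k y s \<partial>lborel)"
      proof (rule nn_integral_mono)
        fix s :: real
        show "ennreal (tail F (x / y)) * indicator {ln y - 1..<ln y} s \<le> k y s"
        proof (cases "s \<in> {ln y - 1..<ln y}")
          case s: True
          have "y \<le> exp (s + 1)" using s y by (metis add.commute atLeastLessThan_iff diff_le_eq ln_ge_iff exp_le_cancel_iff exp_ln)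
          then have "x / exp s \<le> exp 1 * (x / y)"
            using y \<open>x > 0\<close> by (simp add: field_simps exp_add)
          have "tail F (x / y) \<le> C * tail F (exp 1 * (x / y))"
            using y \<open>x > 0\<close> by (intro C) simp
          also have "\<dots> \<le> C * tail F (x / exp s)"
            using \<open>C \<ge> 0\<close> \<open>x / exp s \<le> _\<close> by (intro mult_left_mono F_antimono)
          finally show ?thesis using s True \<open>C \<ge> 0\<close>
            by (simp add: k_def ennreal_mult[symmetric] ennreal_leI)
        qed simp
      qed
      finally show ?thesis using True by simp
    qed simp
  qed
  also have "\<dots> = (\<integral>\<^sup>+s. (\<integral>\<^sup>+y. k y s \<partial>G) \<partial>lborel)"
    by (rule Fubini'[symmetric]) simp
  also have "\<dots> \<le> (\<integral>\<^sup>+s. ennreal C * (ennreal (tail F (x / exp s) * tail G (exp s)) * indicator {ln A - 1..ln B} s) \<partial>lborel)"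
  proof (rule nn_integral_mono)
    fix s :: real
    have "(\<integral>\<^sup>+y. k y s \<partial>G) \<le> (\<integral>\<^sup>+y. ennreal C * ennreal (tail F (x / exp s)) * indicator {ln A - 1..ln B} s * indicator {exp s<..} y \<partial>G)"
    proof (rule nn_integral_mono)
      fix y
      have "s \<in> {ln A - 1..ln B} \<and> y \<in> {exp s<..}" if "y \<in> {A<..B}" "s \<in> {ln y - 1..<ln y}"
      proof -
        have y: "y > 0" using that \<open>A > 0\<close> by simp
        have "ln A \<le> ln y" "ln y \<le> ln B" using that \<open>A > 0\<close> y by auto
        moreover have "exp s < y" using that y by (metis atLeastLessThan_iff exp_less_cancel_iff exp_ln)
        ultimately show ?thesis using that by auto
      qed
      then show "k y s \<le> ennreal C * ennreal (tail F (x / exp s)) * indicator {ln A - 1..ln B} s * indicator {exp s<..} y"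
        by (auto simp: k_def indicator_def)
    qed
    also have "\<dots> = ennreal C * ennreal (tail F (x / exp s)) * indicator {ln A - 1..ln B} s * emeasure G {exp s<..}"
      by (subst nn_integral_cmult_indicator) auto
    also have "emeasure G {exp s<..} = ennreal (tail G (exp s))"
      by (simp add: tail_def G.emeasure_eq_measure)
    finally show "(\<integral>\<^sup>+y. k y s \<partial>G) \<le> ennreal C * (ennreal (tail F (x / exp s) * tail G (exp s)) * indicator {ln A - 1..ln B} s)"
      by (simp add: ennreal_mult mult_ac)
  qed
  also have "\<dots> = ennreal C * (\<integral>\<^sup>+s\<in>{ln A - 1..ln B}. ennreal (tail F (x / exp s) * tail G (exp s)) \<partial>lborel)"
    by (rule nn_integral_cmult) measurable
  finally show ?thesis .
qed

text \<open>Values \<open>y > x\<close> contribute at most \<open>tail G x\<close>.\<close>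
lemma large_factor_negligibleI:
  assumes G: "real_distribution G" and small: "tail G \<in> o[at_top](tail F)"
    and trunc: "\<And>\<epsilon>. \<epsilon> > 0 \<Longrightarrow> \<exists>K>0. \<forall>\<^sub>F x in at_top.
        (\<integral>\<^sup>+y\<in>{K<..x}. ennreal (tail F (x / y)) \<partial>G) \<le> ennreal (\<epsilon> * tail F x)"
  shows "large_factor_negligible F G"
  unfolding large_factor_negligible_def
proof (intro allI impI)
  interpret G: real_distribution G by fact
  note [measurable] = dist_F G
  fix \<epsilon> :: real assume "\<epsilon> > 0"
  from trunc[of "\<epsilon> / 2"] \<open>\<epsilon> > 0\<close> obtain K where "K > 0"
    and K: "\<forall>\<^sub>F x in at_top. (\<integral>\<^sup>+y\<in>{K<..x}. ennreal (tail F (x / y)) \<partial>G) \<le> ennreal (\<epsilon> / 2 * tail F x)"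
    by auto
  have "\<forall>\<^sub>F x in at_top. norm (tail G x) \<le> \<epsilon> / 2 * norm (tail F x)"
    using small \<open>\<epsilon> > 0\<close> by (intro landau_o.smallD) auto
  with K have "\<forall>\<^sub>F x in at_top. (\<integral>\<^sup>+y\<in>{K<..}. ennreal (tail F (x / y)) \<partial>G) \<le> ennreal (\<epsilon> * tail F x)"
  proof eventually_elim
    case (elim x)
    have "(\<integral>\<^sup>+y\<in>{K<..}. ennreal (tail F (x / y)) \<partial>G) \<le>
      (\<integral>\<^sup>+y. ennreal (tail F (x / y)) * indicator {K<..x} y + indicator {x<..} y \<partial>G)"
      using F_le_1 by (intro nn_integral_mono) (auto simp: indicator_def)
    also have "\<dots> = (\<integral>\<^sup>+y\<in>{K<..x}. ennreal (tail F (x / y)) \<partial>G) + ennreal (tail G x)"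
      unfolding tail_def[of G] G.emeasure_eq_measure[symmetric] by (subst nn_integral_add) auto
    also have "\<dots> \<le> ennreal (\<epsilon> / 2 * tail F x) + ennreal (\<epsilon> / 2 * tail F x)"
      using elim by (intro add_mono ennreal_leI) auto
    also have "\<dots> = ennreal (\<epsilon> * tail F x)"
      using \<open>\<epsilon> > 0\<close> by (subst ennreal_plus[symmetric]) auto
    finally show ?case .
  qed
  with \<open>K > 0\<close> show "\<exists>K>0. \<forall>\<^sub>F x in at_top. (\<integral>\<^sup>+y\<in>{K<..}. ennreal (tail F (x / y)) \<partial>G) \<le> ennreal (\<epsilon> * tail F x)"
    by blast
qed

text \<open>If \<open>tail G x\<close> is \<open>o(x\<^sup>-\<^sup>\<alpha> h(ln x))\<close>, the logarithmic convolution is a small multiple of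
\<open>x\<^sup>-\<^sup>\<alpha>\<close> times the additive convolution of \<open>L(e\<^sup>s)\<close> and \<open>h\<close> at \<open>ln x\<close>. A bound of the latter by a multiple
of \<open>L(x)\<close> is therefore all that is needed.\<close>
lemma negligible_if_convolution_bound:
  assumes G: "real_distribution G" and small: "tail G \<in> o[at_top](tail F)"
    and h[measurable]: "h \<in> borel_measurable borel" and h_nonneg: "\<And>s. s \<ge> 0 \<Longrightarrow> h s \<ge> 0"
    and tail_G: "tail G \<in> o[at_top](\<lambda>x. x powr (-\<alpha>) * h (ln x))"
    and "D \<ge> 0"
    and conv: "\<forall>\<^sub>F T in at_top. (\<integral>\<^sup>+s\<in>{0..T}. ennreal (slow_part \<alpha> F (exp (T - s)) * h s) \<partial>lborel)
      \<le> ennreal (D * slow_part \<alpha> F (exp T))"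
  shows "large_factor_negligible F G"
proof (rule large_factor_negligibleI[OF G small])
  fix \<epsilon> :: real assume "\<epsilon> > 0"
  obtain C where C: "C \<ge> 1" "\<And>t. t \<ge> 0 \<Longrightarrow> tail F t \<le> C * tail F (exp 1 * t)"
    using dilation_bound by blast
  define \<delta> where "\<delta> = \<epsilon> / (C * D + 1)"
  have pos: "C * D + 1 > 0" using C \<open>D \<ge> 0\<close> by (intro add_nonneg_pos) auto
  have "\<delta> > 0" using \<open>\<epsilon> > 0\<close> pos by (simp add: \<delta>_def)
  have "\<forall>\<^sub>F x in at_top. norm (tail G x) \<le> \<delta> * norm (x powr (-\<alpha>) * h (ln x))"
    using tail_G \<open>\<delta> > 0\<close> by (rule landau_o.smallD)
  then obtain z where z: "\<And>x. x \<ge> z \<Longrightarrow> norm (tail G x) \<le> \<delta> * norm (x powr (-\<alpha>) * h (ln x))"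
    by (auto simp: eventually_at_top_linorder)
  \<comment> \<open>The factor \<open>e\<close> compensates the shift of the lower limit by one, so that the integration starts at
    \<open>ln (max 1 z)\<close>, inside \<open>[0, \<infinity>)\<close> and where the bound on \<open>tail G\<close> is valid.\<close>
  define K where "K = exp 1 * max 1 z"
  have "K > 0" by (simp add: K_def)
  have K: "ln K - 1 = ln (max 1 z)" by (simp add: K_def ln_mult)
  have ev: "\<forall>\<^sub>F x in at_top. (\<integral>\<^sup>+s\<in>{0..ln x}. ennreal (slow_part \<alpha> F (exp (ln x - s)) * h s) \<partial>lborel)
      \<le> ennreal (D * slow_part \<alpha> F (exp (ln x)))"
    using conv ln_at_top by (rule eventually_compose_filterlim)
  have "\<forall>\<^sub>F x in at_top. (\<integral>\<^sup>+y\<in>{K<..x}. ennreal (tail F (x / y)) \<partial>G) \<le> ennreal (\<epsilon> * tail F x)"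
    using ev eventually_gt_at_top[of 0]
  proof eventually_elim
    case (elim x)
    have "(\<integral>\<^sup>+y\<in>{K<..x}. ennreal (tail F (x / y)) \<partial>G) \<le>
      ennreal C * (\<integral>\<^sup>+s\<in>{ln K - 1..ln x}. ennreal (tail F (x / exp s) * tail G (exp s)) \<partial>lborel)"
      using C elim \<open>K > 0\<close> by (intro product_tail_le_log_convolution[OF G]) auto
    also have "\<dots> \<le> ennreal C * (\<integral>\<^sup>+s. ennreal (\<delta> * x powr (-\<alpha>)) *
        (ennreal (slow_part \<alpha> F (exp (ln x - s)) * h s) * indicator {0..ln x} s) \<partial>lborel)"
    proof (intro mult_left_mono nn_integral_mono)
      fix s :: real
      show "ennreal (tail F (x / exp s) * tail G (exp s)) * indicator {ln K - 1..ln x} s \<le>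
        ennreal (\<delta> * x powr (-\<alpha>)) * (ennreal (slow_part \<alpha> F (exp (ln x - s)) * h s) * indicator {0..ln x} s)"
      proof (cases "s \<in> {ln K - 1..ln x}")
        case True
        then have "ln (max 1 z) \<le> s" using K by simp
        then have "max 1 z \<le> exp s" using ln_le_cancel_iff[of "max 1 z" "exp s"] by simp
        then have "z \<le> exp s" "1 \<le> exp s" by auto
        then have s: "z \<le> exp s" "0 \<le> s" by auto
        have "tail F (x / exp s) * tail G (exp s) \<le> tail F (x / exp s) * (\<delta> * (exp s powr (-\<alpha>) * h s))"
          using z[OF s(1)] h_nonneg[OF s(2)] by (intro mult_left_mono) (auto simp: abs_mult)
        also have "\<dots> = \<delta> * x powr (-\<alpha>) * (slow_part \<alpha> F (exp (ln x - s)) * h s)"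
          using elim(2) by (simp add: slow_part_def exp_diff powr_divide powr_minus field_simps)
        finally have "tail F (x / exp s) * tail G (exp s) \<le> \<delta> * x powr (-\<alpha>) * (slow_part \<alpha> F (exp (ln x - s)) * h s)" .
        from ennreal_leI[OF this] show ?thesis using True s \<open>\<delta> > 0\<close> by (simp add: ennreal_mult'[symmetric])
      qed simp
    qed simp
    also have "\<dots> = ennreal C * (ennreal (\<delta> * x powr (-\<alpha>)) *
        (\<integral>\<^sup>+s\<in>{0..ln x}. ennreal (slow_part \<alpha> F (exp (ln x - s)) * h s) \<partial>lborel))"
      by (subst nn_integral_cmult) auto
    also have "\<dots> \<le> ennreal C * (ennreal (\<delta> * x powr (-\<alpha>)) * ennreal (D * slow_part \<alpha> F (exp (ln x))))"
      using elim by (intro mult_left_mono) auto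
    also have "\<dots> = ennreal (C * (\<delta> * x powr (-\<alpha>) * (D * slow_part \<alpha> F (exp (ln x)))))"
      using C \<open>\<delta> > 0\<close> \<open>D \<ge> 0\<close> slow_part_pos[of x] elim by (simp add: ennreal_mult)
    also have "C * (\<delta> * x powr (-\<alpha>) * (D * slow_part \<alpha> F (exp (ln x)))) = (\<delta> * (C * D)) * tail F x"
      using elim by (simp add: slow_part_def powr_minus field_simps)
    also have "\<dots> \<le> \<epsilon> * tail F x"
      using pos \<open>\<epsilon> > 0\<close> by (intro mult_right_mono) (auto simp: \<delta>_def field_simps)
    finally show ?case by (simp add: ennreal_leI)
  qed
  with \<open>K > 0\<close> show "\<exists>K>0. \<forall>\<^sub>F x in at_top. (\<integral>\<^sup>+y\<in>{K<..x}. ennreal (tail F (x / y)) \<partial>G) \<le> ennreal (\<epsilon> * tail F x)"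
    by blast
qed

end

lemma class_Sd_convolution_bound:
  assumes "class_Sd f" and [measurable]: "f \<in> borel_measurable borel"
  obtains D where "D \<ge> 0"
    "\<forall>\<^sub>F x in at_top. (\<integral>\<^sup>+y\<in>{0..x}. ennreal (f (x - y) * f y) \<partial>lborel) \<le> ennreal (D * f x)"
proof -
  define I where "I = (\<integral>\<^sup>+u\<in>{0..}. ennreal (f u) \<partial>lborel)"
  have pos: "\<forall>\<^sub>F x in at_top. f x > 0"
    and fin: "I < \<infinity>"
    and lim: "((\<lambda>x. \<integral>\<^sup>+y\<in>{0..x}. ennreal (f (x - y) / f x * f y) \<partial>lborel) \<longlongrightarrow> 2 * I) at_top"
    using assms(1) unfolding class_Sd_def I_def by auto
  define D where "D = enn2real (2 * I) + 1"
  have "2 * I < \<infinity>" using fin by (simp add: ennreal_mult_less_top)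
  then have "2 * I = ennreal (enn2real (2 * I))" by simp
  also have "\<dots> < ennreal D" by (simp add: D_def ennreal_lessI)
  finally have "2 * I < ennreal D" .
  with lim have "\<forall>\<^sub>F x in at_top. (\<integral>\<^sup>+y\<in>{0..x}. ennreal (f (x - y) / f x * f y) \<partial>lborel) < ennreal D"
    by (rule order_tendstoD)
  with pos have "\<forall>\<^sub>F x in at_top. (\<integral>\<^sup>+y\<in>{0..x}. ennreal (f (x - y) * f y) \<partial>lborel) \<le> ennreal (D * f x)"
  proof eventually_elim
    case (elim x)
    have "(\<integral>\<^sup>+y\<in>{0..x}. ennreal (f (x - y) * f y) \<partial>lborel) =
      (\<integral>\<^sup>+y. ennreal (f x) * (ennreal (f (x - y) / f x * f y) * indicator {0..x} y) \<partial>lborel)"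
      using elim by (intro nn_integral_cong) (auto simp: indicator_def ennreal_mult'[symmetric])
    also have "\<dots> = ennreal (f x) * (\<integral>\<^sup>+y\<in>{0..x}. ennreal (f (x - y) / f x * f y) \<partial>lborel)"
      by (subst nn_integral_cmult) auto
    also have "\<dots> \<le> ennreal (f x) * ennreal D"
      using elim by (intro mult_left_mono) auto
    also have "\<dots> = ennreal (D * f x)"
      using elim by (simp add: ennreal_mult'' mult.commute)
    finally show ?case .
  qed
  moreover have "D \<ge> 0" by (simp add: D_def)
  ultimately show ?thesis using that by blast
qed

context regularly_varying
begin

lemma DZ2_imp_negligible:
  assumes G: "real_distribution G" and small: "tail G \<in> o[at_top](tail F)" and "DZ2 \<alpha> F"
  shows "large_factor_negligible F G"
proof -
  let ?l = "\<lambda>x. slow_part \<alpha> F (exp x)"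
  have "class_Sd ?l" using \<open>DZ2 \<alpha> F\<close> by (simp add: DZ2_def)
  then obtain D where D: "D \<ge> 0"
    "\<forall>\<^sub>F x in at_top. (\<integral>\<^sup>+y\<in>{0..x}. ennreal (?l (x - y) * ?l y) \<partial>lborel) \<le> ennreal (D * ?l x)"
    by (rule class_Sd_convolution_bound) auto
  have "\<forall>\<^sub>F x in at_top. tail F x = x powr (-\<alpha>) * ?l (ln x)"
    using eventually_gt_at_top[of 0]
    by eventually_elim (simp add: slow_part_def powr_minus)
  then have "tail G \<in> o[at_top](\<lambda>x. x powr (-\<alpha>) * ?l (ln x))"
    using small by (subst landau_o.small.cong[symmetric])
  with D show ?thesis
    using slow_part_pos by (intro negligible_if_convolution_bound[OF G small]) (auto simp: less_imp_le)
qed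

text \<open>Both representations of \<open>L\<close> are covered: \<open>g = 1\<close> for \<open>L(x) = c(x) P(U > log x)\<close>, and \<open>g\<close> the tail of \<open>V\<close>
for the quotient. The denominator is harmless, because \<open>1 / g\<close> is increasing, so that in the convolution at
\<open>T\<close> it can be replaced by \<open>1 / g T\<close> and pulled out of the integral.\<close>
lemma negligible_if_log_subexponential:
  assumes G: "real_distribution G" and small: "tail G \<in> o[at_top](tail F)"
    and U: "real_distribution U" "\<And>x. tail U x > 0" "class_S_star U"
    and g: "\<And>x. g x > 0" "antimono g"
    and c: "c\<^sub>0 > 0" "(c \<longlongrightarrow> c\<^sub>0) at_top"
    and L: "\<And>x. x > 0 \<Longrightarrow> slow_part \<alpha> F x = c x * (tail U (ln x) / g (ln x))"
    and tail_G: "tail G \<in> o[at_top](\<lambda>x. x powr (-\<alpha>) * tail U (ln x))"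
  shows "large_factor_negligible F G"
proof -
  note [measurable] = U(1)
  obtain D where D: "D \<ge> 0"
    "\<forall>\<^sub>F x in at_top. (\<integral>\<^sup>+y\<in>{0..x}. ennreal (tail U (x - y) * tail U y) \<partial>lborel) \<le> ennreal (D * tail U x)"
    using U(3)[unfolded class_S_star_def] by (rule class_Sd_convolution_bound) auto
  have c_pos: "c x > 0" if "x > 0" for x
    using slow_part_pos[OF that] L[OF that] U(2) g(1) by (metis divide_pos_pos zero_less_mult_pos2)
  have ev1: "\<forall>\<^sub>F x in at_top. c x < 2 * c\<^sub>0" and ev2: "\<forall>\<^sub>F x in at_top. c x > c\<^sub>0 / 2"
    by (rule order_tendstoD[OF c(2)]; use c(1) in simp)+
  obtain z where z: "\<And>x. x \<ge> z \<Longrightarrow> c x < 2 * c\<^sub>0"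
    using ev1 by (auto simp: eventually_at_top_linorder)
  define z' where "z' = max 1 z"
  have "z' > 0" "z' \<ge> z" by (auto simp: z'_def)
  \<comment> \<open>The first entry serves for large arguments, where \<open>c < 2 * c\<^sub>0\<close>, the second for \<open>0 \<le> t \<le> ln z'\<close>, where
    monotonicity of the two tails bounds their quotient from below.\<close>
  define B where "B = max (2 * c\<^sub>0) (z' powr \<alpha> * g 0 / tail U (ln z'))"
  have "B \<ge> 0" using c by (simp add: B_def)
  have B: "slow_part \<alpha> F (exp t) \<le> B * (tail U t / g t)" if "t \<ge> 0" for t
  proof (cases "exp t \<ge> z'")
    case True
    have "slow_part \<alpha> F (exp t) = c (exp t) * (tail U t / g t)" using L[of "exp t"] by simp
    also have "\<dots> \<le> B * (tail U t / g t)"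
      using z[of "exp t"] True \<open>z' \<ge> z\<close> g(1)[of t] by (intro mult_right_mono) (auto simp: B_def)
    finally show ?thesis .
  next
    case False
    then have "t \<le> ln z'" using \<open>z' > 0\<close> by (simp add: ln_ge_iff)
    have "slow_part \<alpha> F (exp t) \<le> z' powr \<alpha> * 1" unfolding slow_part_def
      using False index_pos F_le_1 by (intro mult_mono powr_mono2) auto
    also have "\<dots> = (z' powr \<alpha> * g 0 / tail U (ln z')) * (tail U (ln z') / g 0)"
      using U(2)[of "ln z'"] g(1)[of 0] by simp
    also have "\<dots> \<le> B * (tail U t / g t)"
    proof (rule mult_mono)
      show "tail U (ln z') / g 0 \<le> tail U t / g t"
        using \<open>t \<le> ln z'\<close> that g(1) antimonoD[OF g(2) that]
        by (intro frac_le tail_antimono[OF U(1)]) auto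
    qed (use g(1)[of 0] \<open>B \<ge> 0\<close> in \<open>auto simp: B_def\<close>)
    finally show ?thesis .
  qed
  have ev2': "\<forall>\<^sub>F T in at_top. c (exp T) > c\<^sub>0 / 2"
    using ev2 exp_at_top by (rule eventually_compose_filterlim)
  have "\<forall>\<^sub>F T in at_top. (\<integral>\<^sup>+s\<in>{0..T}. ennreal (slow_part \<alpha> F (exp (T - s)) * tail U s) \<partial>lborel)
      \<le> ennreal (B * D * (2 / c\<^sub>0) * slow_part \<alpha> F (exp T))"
    using D(2) ev2'
  proof eventually_elim
    case (elim T)
    have gT: "g T > 0" by (rule g)
    have "(\<integral>\<^sup>+s\<in>{0..T}. ennreal (slow_part \<alpha> F (exp (T - s)) * tail U s) \<partial>lborel) \<le>
      (\<integral>\<^sup>+s. ennreal (B / g T) * (ennreal (tail U (T - s) * tail U s) * indicator {0..T} s) \<partial>lborel)"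
    proof (rule nn_integral_mono)
      fix s :: real
      show "ennreal (slow_part \<alpha> F (exp (T - s)) * tail U s) * indicator {0..T} s \<le>
        ennreal (B / g T) * (ennreal (tail U (T - s) * tail U s) * indicator {0..T} s)"
      proof (cases "s \<in> {0..T}")
        case True
        have "slow_part \<alpha> F (exp (T - s)) \<le> B * (tail U (T - s) / g (T - s))"
          using True by (intro B) auto
        also have "\<dots> \<le> B * (tail U (T - s) / g T)"
          using True gT \<open>B \<ge> 0\<close> by (intro mult_left_mono divide_left_mono antimonoD[OF g(2)] mult_pos_pos g) auto
        finally have "slow_part \<alpha> F (exp (T - s)) * tail U s \<le> B * (tail U (T - s) / g T) * tail U s"
          by (intro mult_right_mono) auto
        then show ?thesis using True \<open>B \<ge> 0\<close> gT
          by (simp add: ennreal_mult'[symmetric] ennreal_leI)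
      qed simp
    qed
    also have "\<dots> = ennreal (B / g T) * (\<integral>\<^sup>+s\<in>{0..T}. ennreal (tail U (T - s) * tail U s) \<partial>lborel)"
      by (subst nn_integral_cmult) auto
    also have "\<dots> \<le> ennreal (B / g T) * ennreal (D * tail U T)"
      using elim by (intro mult_left_mono) auto
    also have "\<dots> = ennreal (B * D * (tail U T / g T))"
      using \<open>B \<ge> 0\<close> \<open>D \<ge> 0\<close> gT by (simp add: ennreal_mult'[symmetric])
    also have "\<dots> \<le> ennreal (B * D * (2 / c\<^sub>0 * slow_part \<alpha> F (exp T)))"
    proof (intro ennreal_leI mult_left_mono)
      have "c\<^sub>0 / 2 * (tail U T / g T) \<le> c (exp T) * (tail U T / g T)"
        using elim gT by (intro mult_right_mono) auto
      then have "c\<^sub>0 / 2 * (tail U T / g T) \<le> slow_part \<alpha> F (exp T)"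
        using L[of "exp T"] by simp
      then show "tail U T / g T \<le> 2 / c\<^sub>0 * slow_part \<alpha> F (exp T)"
        using c gT by (simp add: field_simps)
    qed (use \<open>B \<ge> 0\<close> \<open>D \<ge> 0\<close> in auto)
    finally show ?case by (simp add: mult.assoc)
  qed
  moreover have "B * D * (2 / c\<^sub>0) \<ge> 0" using \<open>B \<ge> 0\<close> \<open>D \<ge> 0\<close> c by simp
  ultimately show ?thesis
    using tail_G by (intro negligible_if_convolution_bound[OF G small, of "tail U"]) auto
qed

lemma DZ3_imp_negligible:
  assumes G: "real_distribution G" and small: "tail G \<in> o[at_top](tail F)" and "DZ3 \<alpha> F G"
  shows "large_factor_negligible F G"
proof -
  obtain U where U: "class_S_star U" "tail G \<in> o[at_top](\<lambda>x. x powr (-\<alpha>) * tail U (ln x))"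
    and type: "type_iii (slow_part \<alpha> F) U \<or> (\<exists>V. type_iv (slow_part \<alpha> F) U V)"
    using \<open>DZ3 \<alpha> F G\<close> unfolding DZ3_def by blast
  from type show ?thesis
  proof (elim disjE exE)
    assume *: "type_iii (slow_part \<alpha> F) U"
    then obtain c c\<^sub>0 where "0 < c\<^sub>0" "(c \<longlongrightarrow> c\<^sub>0) at_top" "\<And>x. x > 0 \<Longrightarrow> slow_part \<alpha> F x = c x * tail U (ln x)"
      unfolding type_iii_def by blast
    with * U show ?thesis
      by (intro negligible_if_log_subexponential[OF G small, of U "\<lambda>_. 1" c\<^sub>0 c])
         (auto simp: type_iii_def long_tailed_pos antimono_def)
  next
    fix V assume *: "type_iv (slow_part \<alpha> F) U V"
    then obtain c c\<^sub>0 where "0 < c\<^sub>0" "(c \<longlongrightarrow> c\<^sub>0) at_top"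
      "\<And>x. x > 0 \<Longrightarrow> slow_part \<alpha> F x = c x * (tail U (ln x) / tail V (ln x))"
      unfolding type_iv_def by blast
    with * U show ?thesis
      by (intro negligible_if_log_subexponential[OF G small, of U "tail V" c\<^sub>0 c])
         (auto simp: type_iv_def long_tailed_pos antimono_def tail_antimono)
  qed
qed

end

section \<open>Moments and truncated moments\<close>

lemma powr_moment_tail_small:
  assumes G: "real_distribution G" and int: "integrable G (\<lambda>y. y powr \<alpha>)" and "\<delta> > 0"
  shows "\<forall>\<^sub>F K in at_top. (\<integral>\<^sup>+y\<in>{K<..}. ennreal (y powr \<alpha>) \<partial>G) \<le> ennreal \<delta>"
proof -
  interpret G: real_distribution G by fact
  have "((\<lambda>K. \<integral>y. y powr \<alpha> * indicator {K<..} y \<partial>G) \<longlongrightarrow> (\<integral>y. 0 \<partial>G)) at_top"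
  proof (rule integral_dominated_convergence_at_top[where w = "\<lambda>y. y powr \<alpha>"])
    show "AE y in G. ((\<lambda>K. y powr \<alpha> * indicator {K<..} y) \<longlongrightarrow> (0::real)) at_top"
    proof (rule AE_I2)
      fix y :: real
      have "\<forall>\<^sub>F K in at_top. y powr \<alpha> * indicator {K<..} y = (0::real)"
        using eventually_gt_at_top[of y] by eventually_elim auto
      then show "((\<lambda>K. y powr \<alpha> * indicator {K<..} y) \<longlongrightarrow> (0::real)) at_top"
        by (rule tendsto_eventually)
    qed
  qed (auto simp: int indicator_def intro!: always_eventually)
  then have "\<forall>\<^sub>F K in at_top. (\<integral>y. y powr \<alpha> * indicator {K<..} y \<partial>G) < \<delta>"
    using \<open>\<delta> > 0\<close> by (intro order_tendstoD) auto
  then show ?thesis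
  proof eventually_elim
    case (elim K)
    have "(\<integral>\<^sup>+y\<in>{K<..}. ennreal (y powr \<alpha>) \<partial>G) = (\<integral>\<^sup>+y. ennreal (y powr \<alpha> * indicator {K<..} y) \<partial>G)"
      by (intro nn_integral_cong) (auto simp: indicator_def)
    also have "\<dots> = ennreal (\<integral>y. y powr \<alpha> * indicator {K<..} y \<partial>G)"
      by (intro nn_integral_eq_integral integrable_real_mult_indicator int) auto
    finally show ?case using elim by (simp add: ennreal_leI)
  qed
qed

context regularly_varying
begin

lemma truncated_moment_integrable:
  "integrable F (\<lambda>v. v powr \<alpha> * indicator {0..x} v)"
proof (rule integrable_const_bound[where B = "x powr \<alpha>"])
  show "AE v in F. norm (v powr \<alpha> * indicator {0..x} v) \<le> x powr \<alpha>"
    using index_pos by (intro AE_I2) (auto simp: indicator_def intro!: powr_mono2)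
qed measurable

lemma truncated_moment_eq: "truncated_moment \<alpha> F x = (\<integral>v. v powr \<alpha> * indicator {0..x} v \<partial>F)"
  by (simp add: truncated_moment_def set_lebesgue_integral_def mult.commute)

lemma truncated_moment_nonneg: "0 \<le> truncated_moment \<alpha> F x"
  unfolding truncated_moment_eq by (intro integral_nonneg_AE AE_I2) auto

lemma truncated_moment_mono: "x \<le> y \<Longrightarrow> truncated_moment \<alpha> F x \<le> truncated_moment \<alpha> F y"
  unfolding truncated_moment_eq
  by (intro integral_mono truncated_moment_integrable) (auto simp: indicator_def)

lemma truncated_moment_lower_bound:
  assumes "0 < a" "a \<le> b"
  shows "a powr \<alpha> * (tail F a - tail F b) \<le> truncated_moment \<alpha> F b"
proof -
  have "tail F a = measure F ({a<..b} \<union> {b<..})"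
    unfolding tail_def using assms by (intro arg_cong2[where f = measure]) auto
  also have "\<dots> = measure F {a<..b} + tail F b"
    unfolding tail_def by (rule finite_measure_Union) auto
  finally have "a powr \<alpha> * (tail F a - tail F b) = (\<integral>v. a powr \<alpha> * indicator {a<..b} v \<partial>F)"
    by simp
  also have "\<dots> \<le> (\<integral>v. v powr \<alpha> * indicator {0..b} v \<partial>F)"
  proof (rule integral_mono[OF _ truncated_moment_integrable])
    show "integrable F (\<lambda>v. a powr \<alpha> * indicator {a<..b} v)"
      by (intro integrable_mult_right integrable_real_indicator) (auto simp: emeasure_eq_measure)
  qed (use assms index_pos in \<open>auto simp: indicator_def intro!: powr_mono2\<close>)
  finally show ?thesis by (simp add: truncated_moment_eq)
qed

text \<open>A weak form of Karamata's theorem: the mass of \<open>F\<close> between \<open>x / e\<close> and \<open>x\<close> is comparable to \<open>tail F x\<close>, and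
on this interval \<open>v\<^sup>\<alpha>\<close> is comparable to \<open>x\<^sup>\<alpha>\<close>.\<close>
lemma slow_part_le_truncated_moment:
  obtains D where "D > 0" "\<forall>\<^sub>F x in at_top. slow_part \<alpha> F x \<le> D * truncated_moment \<alpha> F x"
proof -
  define \<kappa> where "\<kappa> = (exp 1 powr \<alpha> - 1) / 2"
  have "exp 1 powr \<alpha> > (1::real)" using index_pos by simp
  then have "\<kappa> > 0" "1 + \<kappa> < exp 1 powr \<alpha>" by (auto simp: \<kappa>_def field_simps)
  have "((\<lambda>x. tail F (x / exp 1) / tail F x) \<longlongrightarrow> exp 1 powr \<alpha>) at_top"
    by (rule ratio_limit_div) simp
  then have "\<forall>\<^sub>F x in at_top. 1 + \<kappa> < tail F (x / exp 1) / tail F x"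
    using \<open>1 + \<kappa> < _\<close> by (rule order_tendstoD)
  then have "\<forall>\<^sub>F x in at_top. slow_part \<alpha> F x \<le> (exp 1 powr \<alpha> / \<kappa>) * truncated_moment \<alpha> F x"
    using eventually_gt_at_top[of 0]
  proof eventually_elim
    case (elim x)
    have "\<kappa> * tail F x \<le> tail F (x / exp 1) - tail F x"
      using elim F_pos[of x] by (simp add: field_simps)
    then have "(x / exp 1) powr \<alpha> * (\<kappa> * tail F x) \<le> (x / exp 1) powr \<alpha> * (tail F (x / exp 1) - tail F x)"
      by (intro mult_left_mono) auto
    also have "\<dots> \<le> truncated_moment \<alpha> F x"
      using elim by (intro truncated_moment_lower_bound) (auto simp: field_simps)
    finally show ?case
      using \<open>\<kappa> > 0\<close> elim by (simp add: slow_part_def powr_divide field_simps)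
  qed
  moreover have "exp 1 powr \<alpha> / \<kappa> > 0" using \<open>\<kappa> > 0\<close> by simp
  ultimately show ?thesis using that by blast
qed

lemma nn_integral_exp_tail:
  "(\<integral>\<^sup>+s\<in>{a..}. ennreal (x powr \<alpha> * exp (- \<alpha> * s)) \<partial>lborel) = ennreal (x powr \<alpha> * exp (- \<alpha> * a) / \<alpha>)"
proof -
  have "(\<integral>\<^sup>+s\<in>{a..}. ennreal (x powr \<alpha> * exp (- \<alpha> * s)) \<partial>lborel) =
    ennreal (0 - (- (x powr \<alpha> * exp (- \<alpha> * a) / \<alpha>)))"
  proof (rule nn_integral_FTC_atLeast)
    show "((\<lambda>s. - (x powr \<alpha> * exp (- \<alpha> * s) / \<alpha>)) \<longlongrightarrow> 0) at_top"
    proof -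
      have "((\<lambda>s. exp (- \<alpha> * s)) \<longlongrightarrow> 0) at_top"
        using index_pos
        by (intro filterlim_compose[OF exp_at_bot] filterlim_tendsto_neg_mult_at_bot[OF tendsto_const])
           (auto simp: filterlim_ident)
      then have "((\<lambda>s. - (x powr \<alpha> * exp (- \<alpha> * s) / \<alpha>)) \<longlongrightarrow> - (x powr \<alpha> * 0 / \<alpha>)) at_top"
        using index_pos by (intro tendsto_intros) auto
      then show ?thesis by simp
    qed
  next
    fix s :: real
    show "((\<lambda>s. - (x powr \<alpha> * exp (- \<alpha> * s) / \<alpha>)) has_real_derivative x powr \<alpha> * exp (- \<alpha> * s)) (at s)"
      using index_pos by (auto intro!: derivative_eq_intros)
  qed (auto intro!: borel_measurable_continuous_onI continuous_intros)
  then show ?thesis by simp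
qed

text \<open>After the substitution \<open>u = ln x - s\<close> the integral is that of \<open>e\<^bsup>\<alpha>u\<^esup> tail F (e\<^sup>u)\<close> over \<open>[0, ln x / 2]\<close>. Writing
the tail as an integral over \<open>F\<close> and integrating first in \<open>u\<close> gives \<open>1 / \<alpha>\<close> times the mean of
\<open>min(v, \<surd>x)\<^sup>\<alpha>\<close>, up to the negative lower boundary term, which is dropped.\<close>
lemma log_integral_slow_part_le:
  assumes "x \<ge> 1"
  shows "(\<integral>\<^sup>+s\<in>{ln x / 2..ln x}. ennreal (slow_part \<alpha> F (x / exp s)) \<partial>lborel)
    \<le> ennreal ((truncated_moment \<alpha> F (sqrt x) + slow_part \<alpha> F (sqrt x)) / \<alpha>)"
proof -
  interpret pair_sigma_finite F lborel by unfold_locales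
  note [measurable] = dist_F
  have x: "x > 0" using assms by simp
  define k where "k = (\<lambda>v s. ennreal (x powr \<alpha> * exp (- \<alpha> * s)) * indicator {ln x / 2..ln x} s * indicator {x / exp s<..} v)"
  have k_meas[measurable]: "(\<lambda>p. k (fst p) (snd p)) \<in> borel_measurable (F \<Otimes>\<^sub>M lborel)"
    unfolding k_def indicator_def atLeastAtMost_iff greaterThan_iff by measurable
  have k_meas'[measurable]: "(\<lambda>(v, s). k v s) \<in> borel_measurable (F \<Otimes>\<^sub>M lborel)"
    using k_meas by (simp add: case_prod_beta)
  have int: "integrable F (\<lambda>v. v powr \<alpha> * indicator {0..sqrt x} v / \<alpha>)"
    "integrable F (\<lambda>v. sqrt x powr \<alpha> / \<alpha> * indicator {sqrt x<..} v)"
    by (intro integrable_divide truncated_moment_integrable)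
       (intro integrable_mult_right integrable_real_indicator; simp add: emeasure_eq_measure)
  have sqrt_powr: "sqrt x powr \<alpha> = x powr \<alpha> * exp (- \<alpha> * (ln x / 2))"
    using x by (simp add: powr_def ln_sqrt mult_exp_exp)
  have "(\<integral>\<^sup>+s\<in>{ln x / 2..ln x}. ennreal (slow_part \<alpha> F (x / exp s)) \<partial>lborel) = (\<integral>\<^sup>+s. (\<integral>\<^sup>+v. k v s \<partial>F) \<partial>lborel)"
  proof (rule nn_integral_cong)
    fix s :: real
    have "(x / exp s) powr \<alpha> = x powr \<alpha> * exp (- \<alpha> * s)"
  proof -
      have "exp s powr \<alpha> = exp (\<alpha> * s)" by (simp add: powr_def)
      then show ?thesis using x by (simp add: powr_divide exp_minus field_simps)
    qed
    then have "ennreal (slow_part \<alpha> F (x / exp s)) * indicator {ln x / 2..ln x} s =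
      ennreal (x powr \<alpha> * exp (- \<alpha> * s)) * indicator {ln x / 2..ln x} s * emeasure F {x / exp s<..}"
      by (simp add: slow_part_def tail_def emeasure_eq_measure ennreal_mult mult_ac)
    also have "\<dots> = (\<integral>\<^sup>+v. k v s \<partial>F)"
      unfolding k_def by (subst nn_integral_cmult_indicator) auto
    finally show "ennreal (slow_part \<alpha> F (x / exp s)) * indicator {ln x / 2..ln x} s = (\<integral>\<^sup>+v. k v s \<partial>F)" .
  qed
  also have "\<dots> = (\<integral>\<^sup>+v. (\<integral>\<^sup>+s. k v s \<partial>lborel) \<partial>F)"
    by (rule Fubini'[OF k_meas'])
  also have "\<dots> \<le> (\<integral>\<^sup>+v. ennreal (v powr \<alpha> * indicator {0..sqrt x} v / \<alpha> + sqrt x powr \<alpha> / \<alpha> * indicator {sqrt x<..} v) \<partial>F)"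
  proof (rule nn_integral_mono)
    fix v
    show "(\<integral>\<^sup>+s. k v s \<partial>lborel) \<le> ennreal (v powr \<alpha> * indicator {0..sqrt x} v / \<alpha> + sqrt x powr \<alpha> / \<alpha> * indicator {sqrt x<..} v)"
    proof (cases "v > 0")
      case v: True
      \<comment> \<open>The integrand vanishes below both \<open>ln x / 2\<close> and \<open>ln x - ln v\<close>; \<open>a\<close> is the larger of the two.\<close>
      define a where "a = (if v \<le> sqrt x then ln x - ln v else ln x / 2)"
      have "(\<integral>\<^sup>+s. k v s \<partial>lborel) \<le> (\<integral>\<^sup>+s\<in>{a..}. ennreal (x powr \<alpha> * exp (- \<alpha> * s)) \<partial>lborel)"
      proof (rule nn_integral_mono)
        fix s :: real
        have "a \<le> s" if "s \<in> {ln x / 2..ln x}" "v \<in> {x / exp s<..}"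
        proof -
          have "x < v * exp s" using that by (simp add: field_simps)
          then have "ln x < ln (v * exp s)" using x v by simp
          then have "ln x < ln v + s" using v by (simp add: ln_mult)
          then show ?thesis using that by (auto simp: a_def)
        qed
        then show "k v s \<le> ennreal (x powr \<alpha> * exp (- \<alpha> * s)) * indicator {a..} s"
          by (auto simp: k_def indicator_def)
      qed
      also have "\<dots> = ennreal (x powr \<alpha> * exp (- \<alpha> * a) / \<alpha>)"
        by (rule nn_integral_exp_tail)
      also have "x powr \<alpha> * exp (- \<alpha> * a) / \<alpha> =
        v powr \<alpha> * indicator {0..sqrt x} v / \<alpha> + sqrt x powr \<alpha> / \<alpha> * indicator {sqrt x<..} v"
        using v x sqrt_powr by (auto simp: a_def powr_def mult_exp_exp algebra_simps)
      finally show ?thesis .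
    next
      case False
      have "k v s = 0" for s
      proof -
        have "x / exp s > 0" using x by simp
        then have "v \<notin> {x / exp s<..}" using False by (simp only: greaterThan_iff)
        then show ?thesis by (simp add: k_def)
      qed
      then show ?thesis by simp
    qed
  qed
  also have "\<dots> = ennreal (\<integral>v. v powr \<alpha> * indicator {0..sqrt x} v / \<alpha> + sqrt x powr \<alpha> / \<alpha> * indicator {sqrt x<..} v \<partial>F)"
    using index_pos int by (intro nn_integral_eq_integral Bochner_Integration.integrable_add) auto
  also have "(\<integral>v. v powr \<alpha> * indicator {0..sqrt x} v / \<alpha> + sqrt x powr \<alpha> / \<alpha> * indicator {sqrt x<..} v \<partial>F) =
    (truncated_moment \<alpha> F (sqrt x) + slow_part \<alpha> F (sqrt x)) / \<alpha>"
    using int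
    by (subst Bochner_Integration.integral_add) (auto simp: truncated_moment_eq slow_part_def tail_def add_divide_distrib)
  finally show ?thesis .
qed

text \<open>The range is split at \<open>e \<surd>x\<close> rather than at \<open>\<surd>x\<close>, since smearing over an interval of logarithmic length one
then starts exactly at \<open>s = ln x / 2\<close>: there \<open>e\<^sup>s\<close> lies in \<open>[\<surd>x, x]\<close>, so \<open>L(e\<^sup>s)\<close> is at most a constant times
\<open>L(x)\<close> and the truncated moment at \<open>e\<^sup>s\<close> is at least its value at \<open>\<surd>x\<close>. Below the split the dilation bound
moves the threshold from \<open>x / y\<close> to \<open>e x / y\<close>, which lies in \<open>[\<surd>x, x]\<close>.\<close>
lemma DZ4_imp_negligible:
  assumes G: "real_distribution G" and small: "tail G \<in> o[at_top](tail F)"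
    and moment: "integrable G (\<lambda>y. y powr \<alpha>)" and "DZ4 \<alpha> F G"
  shows "large_factor_negligible F G"
proof (rule large_factor_negligibleI[OF G small])
  fix \<epsilon> :: real assume "\<epsilon> > 0"
  interpret G: real_distribution G by fact
  note [measurable] = dist_F G
  let ?L = "slow_part \<alpha> F" and ?m = "truncated_moment \<alpha> F"
  have tail_G: "tail G \<in> o[at_top](\<lambda>x. tail F x / ?m x)"
    and Limsup: "Limsup at_top (\<lambda>x. SUP y\<in>{sqrt x..x}. ereal (?L y / ?L x)) < \<infinity>"
    using \<open>DZ4 \<alpha> F G\<close> by (auto simp: DZ4_def)
  obtain C where C: "C \<ge> 1" "\<And>t. t \<ge> 0 \<Longrightarrow> tail F t \<le> C * tail F (exp 1 * t)"
    using dilation_bound by blast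
  obtain D where "D > 0" and D: "\<forall>\<^sub>F x in at_top. ?L x \<le> D * ?m x"
    using slow_part_le_truncated_moment by blast
  obtain b where "Limsup at_top (\<lambda>x. SUP y\<in>{sqrt x..x}. ereal (?L y / ?L x)) < ereal b"
    using Limsup ereal_dense2 by blast
  define B where "B = max 1 b"
  have "B \<ge> 1" by (simp add: B_def)
  have B: "\<forall>\<^sub>F x in at_top. \<forall>y\<in>{sqrt x..x}. ?L y \<le> B * ?L x"
    using Limsup_lessD[OF \<open>Limsup _ _ < ereal b\<close>] eventually_gt_at_top[of 0]
  proof eventually_elim
    case (elim x)
    show ?case
    proof
      fix y assume "y \<in> {sqrt x..x}"
      then have "ereal (?L y / ?L x) < ereal b"
        using elim(1) by (meson SUP_upper order_le_less_trans)
      then have "?L y \<le> b * ?L x" using slow_part_pos[of x] elim(2) by (simp add: field_simps)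
      also have "\<dots> \<le> B * ?L x" using slow_part_pos[of x] elim(2) by (intro mult_right_mono) (auto simp: B_def)
      finally show "?L y \<le> B * ?L x" .
    qed
  qed
  \<comment> \<open>The constants make each of the two ranges of \<open>y\<close> contribute at most \<open>\<epsilon> / 2 * tail F x\<close>.\<close>
  define \<delta>\<^sub>1 where "\<delta>\<^sub>1 = \<epsilon> / (2 * (C * B))"
  define \<delta>\<^sub>2 where "\<delta>\<^sub>2 = \<epsilon> * \<alpha> / (2 * (C * (B * (1 + D))))"
  have "\<delta>\<^sub>1 > 0" "\<delta>\<^sub>2 > 0"
    using \<open>\<epsilon> > 0\<close> C \<open>B \<ge> 1\<close> \<open>D > 0\<close> index_pos by (auto simp: \<delta>\<^sub>1_def \<delta>\<^sub>2_def)
  obtain K where K: "K \<ge> exp 1" "(\<integral>\<^sup>+y\<in>{K<..}. ennreal (y powr \<alpha>) \<partial>G) \<le> ennreal \<delta>\<^sub>1"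
    using eventually_conj[OF eventually_ge_at_top[of "exp 1"] powr_moment_tail_small[OF G moment \<open>\<delta>\<^sub>1 > 0\<close>]]
    unfolding eventually_at_top_linorder by blast
  have "K > 0" using K(1) by (rule less_le_trans[OF exp_gt_zero])
  have "\<forall>\<^sub>F x in at_top. norm (tail G x) \<le> \<delta>\<^sub>2 * norm (tail F x / ?m x)"
    using tail_G \<open>\<delta>\<^sub>2 > 0\<close> by (rule landau_o.smallD)
  with D have "\<forall>\<^sub>F x in at_top. ?L x \<le> D * ?m x \<and> norm (tail G x) \<le> \<delta>\<^sub>2 * norm (tail F x / ?m x)"
    by (rule eventually_conj)
  then obtain z where z: "\<And>x. x \<ge> z \<Longrightarrow> ?L x \<le> D * ?m x \<and> norm (tail G x) \<le> \<delta>\<^sub>2 * norm (tail F x / ?m x)"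
    by (auto simp: eventually_at_top_linorder)
  have "\<forall>\<^sub>F x in at_top. sqrt x \<ge> z"
    using sqrt_at_top by (simp add: filterlim_at_top)
  with B eventually_ge_at_top[of "exp 2"]
  have "\<forall>\<^sub>F x in at_top. (\<integral>\<^sup>+y\<in>{K<..x}. ennreal (tail F (x / y)) \<partial>G) \<le> ennreal (\<epsilon> * tail F x)"
  proof eventually_elim
    case (elim x)
    have "x \<ge> 1" using elim(2) by (rule order_trans[rotated]) simp
    then have x: "x > 0" by simp
    have sqrt_sq: "sqrt x * sqrt x = x" using x by simp
    have lower: "tail F (x / y) \<le> C * B * tail F x * y powr \<alpha>" if y: "exp 1 \<le> y" "y \<le> exp 1 * sqrt x" for y
    proof -
      have "y > 0" using y(1) by (rule less_le_trans[OF exp_gt_zero])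
      define w where "w = exp 1 * (x / y)"
      have "w > 0" using x \<open>y > 0\<close> by (simp add: w_def)
      have "sqrt x * y \<le> exp 1 * x"
      proof -
        have "sqrt x * y \<le> sqrt x * (exp 1 * sqrt x)"
          using y(2) x by (intro mult_left_mono) auto
        also have "\<dots> = exp 1 * (sqrt x * sqrt x)" by (simp only: mult_ac)
        finally show ?thesis by (simp only: sqrt_sq)
      qed
      then have w: "w \<in> {sqrt x..x}"
        using y \<open>y > 0\<close> x by (auto simp: w_def field_simps)
      have "tail F (x / y) \<le> C * tail F w"
        unfolding w_def using x \<open>y > 0\<close> by (intro C) simp
      also have "tail F w = w powr (-\<alpha>) * ?L w"
        using \<open>w > 0\<close> by (simp add: slow_part_def powr_minus)
      also have "C * (w powr (-\<alpha>) * ?L w) \<le> C * (w powr (-\<alpha>) * (B * ?L x))"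
        using C elim(1) w by (intro mult_left_mono) auto
      also have "\<dots> = C * B * tail F x * (y / exp 1) powr \<alpha>"
        using x \<open>y > 0\<close> by (simp add: w_def slow_part_def powr_minus powr_divide powr_mult field_simps)
      also have "\<dots> \<le> C * B * tail F x * y powr \<alpha>"
        using C \<open>B \<ge> 1\<close> \<open>y > 0\<close> index_pos
        by (intro mult_left_mono powr_mono2) (auto simp: field_simps)
      finally show ?thesis .
    qed
    have m_pos: "?m (sqrt x) > 0"
    proof -
      have "0 < ?L (sqrt x)" using x by (intro slow_part_pos) simp
      also have "\<dots> \<le> D * ?m (sqrt x)" using z elim(3) by blast
      finally show ?thesis using \<open>D > 0\<close> by (simp add: zero_less_mult_iff)
    qed
    have upper: "tail F (x / exp s) * tail G (exp s) \<le> \<delta>\<^sub>2 * B * tail F x / ?m (sqrt x) * ?L (x / exp s)"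
      if s: "s \<in> {ln x / 2..ln x}" for s
    proof -
      have "exp (ln x / 2) = sqrt x" using x by (simp add: ln_sqrt[symmetric])
      then have "sqrt x \<le> exp s" using s by (metis atLeastAtMost_iff exp_le_cancel_iff)
      moreover have "exp s \<le> x" using s x by (metis atLeastAtMost_iff exp_le_cancel_iff exp_ln)
      ultimately have es: "exp s \<in> {sqrt x..x}" by simp
      have "tail G (exp s) \<le> \<delta>\<^sub>2 * (tail F (exp s) / ?m (exp s))"
        using z[of "exp s"] elim(3) \<open>sqrt x \<le> exp s\<close> truncated_moment_nonneg[of "exp s"] by simp
      also have "\<dots> \<le> \<delta>\<^sub>2 * (tail F (exp s) / ?m (sqrt x))"
        using \<open>\<delta>\<^sub>2 > 0\<close> m_pos truncated_moment_mono[OF \<open>sqrt x \<le> exp s\<close>]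
        by (intro mult_left_mono divide_left_mono) auto
      also have "tail F (exp s) = exp s powr (-\<alpha>) * ?L (exp s)"
        by (simp add: slow_part_def powr_minus)
      also have "\<delta>\<^sub>2 * (exp s powr (-\<alpha>) * ?L (exp s) / ?m (sqrt x)) \<le> \<delta>\<^sub>2 * (exp s powr (-\<alpha>) * (B * ?L x) / ?m (sqrt x))"
        using \<open>\<delta>\<^sub>2 > 0\<close> m_pos elim(1) es by (intro mult_left_mono divide_right_mono) auto
      finally have "tail F (x / exp s) * tail G (exp s) \<le>
          tail F (x / exp s) * (\<delta>\<^sub>2 * (exp s powr (-\<alpha>) * (B * ?L x) / ?m (sqrt x)))"
        by (intro mult_left_mono) auto
      also have "\<dots> = \<delta>\<^sub>2 * B * tail F x / ?m (sqrt x) * ?L (x / exp s)"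
        using x m_pos by (simp add: slow_part_def powr_minus powr_divide field_simps)
      finally show ?thesis .
    qed
    have "(\<integral>\<^sup>+y\<in>{K<..x}. ennreal (tail F (x / y)) \<partial>G) \<le>
      (\<integral>\<^sup>+y. ennreal (C * B * tail F x) * (ennreal (y powr \<alpha>) * indicator {K<..} y)
           + ennreal (tail F (x / y)) * indicator {exp 1 * sqrt x<..x} y \<partial>G)"
    proof (rule nn_integral_mono)
      fix y
      have "ennreal (tail F (x / y)) \<le> ennreal (C * B * tail F x) * ennreal (y powr \<alpha>)"
        if "K < y" "y \<le> exp 1 * sqrt x"
        using lower[of y] that K(1) by (subst ennreal_mult''[symmetric]) (auto intro!: ennreal_leI)
      then show "ennreal (tail F (x / y)) * indicator {K<..x} y \<le>
        ennreal (C * B * tail F x) * (ennreal (y powr \<alpha>) * indicator {K<..} y)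
           + ennreal (tail F (x / y)) * indicator {exp 1 * sqrt x<..x} y"
        by (auto simp: indicator_def not_less)
    qed
    also have "\<dots> = ennreal (C * B * tail F x) * (\<integral>\<^sup>+y\<in>{K<..}. ennreal (y powr \<alpha>) \<partial>G)
      + (\<integral>\<^sup>+y\<in>{exp 1 * sqrt x<..x}. ennreal (tail F (x / y)) \<partial>G)"
      by (subst nn_integral_add) (auto simp: nn_integral_cmult)
    also have "\<dots> \<le> ennreal (\<epsilon> / 2 * tail F x) + ennreal (\<epsilon> / 2 * tail F x)"
    proof (rule add_mono)
      have "ennreal (C * B * tail F x) * (\<integral>\<^sup>+y\<in>{K<..}. ennreal (y powr \<alpha>) \<partial>G) \<le> ennreal (C * B * tail F x) * ennreal \<delta>\<^sub>1"
        using K(2) by (rule mult_left_mono) simp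
      also have "\<dots> = ennreal (\<epsilon> / 2 * tail F x)"
        using \<open>\<delta>\<^sub>1 > 0\<close> C \<open>B \<ge> 1\<close> by (subst ennreal_mult''[symmetric]) (auto simp: \<delta>\<^sub>1_def mult.commute)
      finally show "ennreal (C * B * tail F x) * (\<integral>\<^sup>+y\<in>{K<..}. ennreal (y powr \<alpha>) \<partial>G) \<le> ennreal (\<epsilon> / 2 * tail F x)" .
    next
      have ln_eq: "ln (exp 1 * sqrt x) - 1 = ln x / 2"
        using x by (simp add: ln_mult ln_sqrt)
      let ?c = "\<delta>\<^sub>2 * B * tail F x / ?m (sqrt x)"
      have c: "?c \<ge> 0" using \<open>\<delta>\<^sub>2 > 0\<close> \<open>B \<ge> 1\<close> m_pos by simp
      have "(\<integral>\<^sup>+y\<in>{exp 1 * sqrt x<..x}. ennreal (tail F (x / y)) \<partial>G) \<le>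
        ennreal C * (\<integral>\<^sup>+s\<in>{ln x / 2..ln x}. ennreal (tail F (x / exp s) * tail G (exp s)) \<partial>lborel)"
        unfolding ln_eq[symmetric] using x C by (intro product_tail_le_log_convolution[OF G]) auto
      also have "\<dots> \<le> ennreal C * (\<integral>\<^sup>+s. ennreal ?c * (ennreal (?L (x / exp s)) * indicator {ln x / 2..ln x} s) \<partial>lborel)"
        using upper c
        by (intro mult_left_mono nn_integral_mono)
           (auto simp: indicator_def ennreal_mult'[symmetric] intro!: ennreal_leI)
      also have "\<dots> = ennreal C * (ennreal ?c * (\<integral>\<^sup>+s\<in>{ln x / 2..ln x}. ennreal (?L (x / exp s)) \<partial>lborel))"
        by (subst nn_integral_cmult) auto
      also have "\<dots> \<le> ennreal C * (ennreal ?c * ennreal ((?m (sqrt x) + ?L (sqrt x)) / \<alpha>))"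
        by (intro mult_left_mono log_integral_slow_part_le \<open>x \<ge> 1\<close>) auto
      also have "\<dots> \<le> ennreal C * (ennreal ?c * ennreal ((1 + D) * ?m (sqrt x) / \<alpha>))"
      proof (intro mult_left_mono ennreal_leI divide_right_mono)
        have "?L (sqrt x) \<le> D * ?m (sqrt x)" using z elim(3) by blast
        then show "?m (sqrt x) + ?L (sqrt x) \<le> (1 + D) * ?m (sqrt x)" by (simp add: algebra_simps)
      qed (use index_pos in auto)
      also have "\<dots> = ennreal (C * (?c * ((1 + D) * ?m (sqrt x) / \<alpha>)))"
        using C c by (simp add: ennreal_mult'[symmetric])
      also have "C * (?c * ((1 + D) * ?m (sqrt x) / \<alpha>)) = (\<delta>\<^sub>2 * (2 * (C * (B * (1 + D)))) / \<alpha>) / 2 * tail F x"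
        using m_pos index_pos by (simp add: field_simps)
      also have "\<delta>\<^sub>2 * (2 * (C * (B * (1 + D)))) / \<alpha> = \<epsilon>"
        using C \<open>B \<ge> 1\<close> \<open>D > 0\<close> index_pos by (simp add: \<delta>\<^sub>2_def)
      finally show "(\<integral>\<^sup>+y\<in>{exp 1 * sqrt x<..x}. ennreal (tail F (x / y)) \<partial>G) \<le> ennreal (\<epsilon> / 2 * tail F x)" .
    qed
    also have "\<dots> = ennreal (\<epsilon> * tail F x)"
      using \<open>\<epsilon> > 0\<close> by (subst ennreal_plus[symmetric]) auto
    finally show ?case .
  qed
  with \<open>K > 0\<close> show "\<exists>K>0. \<forall>\<^sub>F x in at_top. (\<integral>\<^sup>+y\<in>{K<..x}. ennreal (tail F (x / y)) \<partial>G) \<le> ennreal (\<epsilon> * tail F x)"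
    by blast
qed

end

section \<open>Breiman limits under domination\<close>

lemma tail_eq_cdf:
  assumes "real_distribution \<mu>"
  shows "tail \<mu> x = 1 - cdf \<mu> x"
proof -
  interpret real_distribution \<mu> by fact
  have "tail \<mu> x = measure \<mu> (space \<mu> - {..x})"
    unfolding tail_def by (rule arg_cong2[where f = measure]) auto
  then show ?thesis using prob_compl[of "{..x}"] by (simp add: cdf_def)
qed

lemma tail_at_top: "real_distribution \<mu> \<Longrightarrow> (tail \<mu> \<longlongrightarrow> 0) at_top"
  and tail_at_bot: "real_distribution \<mu> \<Longrightarrow> (tail \<mu> \<longlongrightarrow> 1) at_bot"
proof -
  assume D: "real_distribution \<mu>"
  interpret real_distribution \<mu> by fact
  have "((\<lambda>x. 1 - cdf \<mu> x) \<longlongrightarrow> 1 - 1) at_top" "((\<lambda>x. 1 - cdf \<mu> x) \<longlongrightarrow> 1 - 0) at_bot"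
    by (intro tendsto_intros cdf_lim_at_top_prob cdf_lim_at_bot)+
  then show "(tail \<mu> \<longlongrightarrow> 0) at_top" "(tail \<mu> \<longlongrightarrow> 1) at_bot"
    by (simp_all add: tail_eq_cdf[OF D, abs_def])
qed

context regularly_varying
begin

text \<open>Dominated convergence applies on \<open>y \<le> K\<close>, where the quotient of tails is at most its value at \<open>y = K\<close>. Beyond
\<open>K\<close> both \<open>h\<close> and its limit, which is at most \<open>C y\<^sup>\<alpha>\<close>, have small integrals.\<close>
lemma dominated_breiman_limit:
  assumes G: "real_distribution G" and neg: "large_factor_negligible F G"
    and moment: "integrable G (\<lambda>y. y powr \<alpha>)" and "C \<ge> 0"
    and h_meas[measurable]: "\<And>x. h x \<in> borel_measurable borel"
    and g_meas[measurable]: "g \<in> borel_measurable borel"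
    and dom: "AE y in G. \<forall>x. 0 \<le> h x y \<and> h x y \<le> (if y > 0 then C * (tail F (x / y) / tail F x) else 0)"
    and lim: "AE y in G. ((\<lambda>x. h x y) \<longlongrightarrow> g y) at_top"
  shows "((\<lambda>x. \<integral>y. h x y \<partial>G) \<longlongrightarrow> (\<integral>y. g y \<partial>G)) at_top"
proof (rule tendstoI)
  interpret G: real_distribution G by fact
  note [measurable] = dist_F G
  have g_bound: "AE y in G. 0 \<le> g y \<and> g y \<le> C * y powr \<alpha>"
    using dom lim
  proof eventually_elim
    case (elim y)
    have "0 \<le> g y"
      using elim by (intro tendsto_lowerbound[OF elim(2)] always_eventually) auto
    moreover have "g y \<le> C * y powr \<alpha>"
    proof (cases "y > 0")
      case True
      have "((\<lambda>x. C * (tail F (x / y) / tail F x)) \<longlongrightarrow> C * y powr \<alpha>) at_top"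
        by (intro tendsto_intros ratio_limit_div True)
      from tendsto_le[OF _ this elim(2)] show ?thesis
        using elim True by (auto intro!: always_eventually)
    next
      case False
      then have "g y \<le> 0"
        using elim by (intro tendsto_upperbound[OF elim(2)] always_eventually) auto
      also have "0 \<le> C * y powr \<alpha>" using \<open>C \<ge> 0\<close> by simp
      finally show ?thesis .
    qed
    ultimately show ?case ..
  qed
  have g_int: "integrable G g"
    by (rule Bochner_Integration.integrable_bound[where f = "\<lambda>y. C * y powr \<alpha>"])
       (use moment g_bound \<open>C \<ge> 0\<close> in auto)
  have h_int: "integrable G (h x)" for x
  proof (rule G.integrable_const_bound[where B = "C / tail F x"])
    have *: "C * (tail F (x / y) / tail F x) \<le> C / tail F x" for y
      using \<open>C \<ge> 0\<close> F_le_1[of "x / y"] F_pos[of x] mult_left_mono[of "tail F (x / y)" 1 C]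
      by (simp add: divide_right_mono)
    show "AE y in G. norm (h x y) \<le> C / tail F x"
      using dom
    proof eventually_elim
      case (elim y)
      then have "0 \<le> h x y" "h x y \<le> (if y > 0 then C * (tail F (x / y) / tail F x) else 0)" by auto
      moreover have "0 \<le> C / tail F x" using \<open>C \<ge> 0\<close> by simp
      ultimately show ?case using *[of y] by (cases "y > 0") auto
    qed
  qed simp
  fix e :: real assume "e > 0"
  define \<epsilon> where "\<epsilon> = e / (4 * (C + 1))"
  have "\<epsilon> > 0" using \<open>e > 0\<close> \<open>C \<ge> 0\<close> by (simp add: \<epsilon>_def)
  have C\<epsilon>: "C * \<epsilon> < e / 4" using \<open>e > 0\<close> \<open>C \<ge> 0\<close> by (simp add: \<epsilon>_def field_simps)
  obtain K\<^sub>0 where "K\<^sub>0 > 0" and K\<^sub>0: "\<forall>\<^sub>F x in at_top.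
      (\<integral>\<^sup>+y\<in>{K\<^sub>0<..}. ennreal (tail F (x / y)) \<partial>G) \<le> ennreal (\<epsilon> * tail F x)"
    using neg \<open>\<epsilon> > 0\<close> unfolding large_factor_negligible_def by blast
  obtain K where K: "K \<ge> K\<^sub>0" "(\<integral>\<^sup>+y\<in>{K<..}. ennreal (y powr \<alpha>) \<partial>G) \<le> ennreal \<epsilon>"
    using eventually_conj[OF eventually_ge_at_top[of "K\<^sub>0"] powr_moment_tail_small[OF G moment \<open>\<epsilon> > 0\<close>]]
    unfolding eventually_at_top_linorder by blast
  have "K > 0" using K \<open>K\<^sub>0 > 0\<close> by simp
  have split: "(\<integral>y. f y \<partial>G) = (\<integral>y. f y * indicator {..K} y \<partial>G) + (\<integral>y. f y * indicator {K<..} y \<partial>G)"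
    if "integrable G f" for f :: "real \<Rightarrow> real"
  proof -
    have "(\<integral>y. f y \<partial>G) = (\<integral>y. f y * indicator {..K} y + f y * indicator {K<..} y \<partial>G)"
      by (intro Bochner_Integration.integral_cong) (auto simp: indicator_def)
    also have "\<dots> = (\<integral>y. f y * indicator {..K} y \<partial>G) + (\<integral>y. f y * indicator {K<..} y \<partial>G)"
      by (intro Bochner_Integration.integral_add integrable_real_mult_indicator that) auto
    finally show ?thesis .
  qed
  have bounded_part: "((\<lambda>x. \<integral>y. h x y * indicator {..K} y \<partial>G) \<longlongrightarrow> (\<integral>y. g y * indicator {..K} y \<partial>G)) at_top"
  proof (rule integral_dominated_convergence_at_top[where w = "\<lambda>_. C * (K powr \<alpha> + 1)"])
    show "AE y in G. ((\<lambda>x. h x y * indicator {..K} y) \<longlongrightarrow> g y * indicator {..K} y) at_top"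
      using lim by (elim eventually_mono) (intro tendsto_intros)
    have "\<forall>\<^sub>F x in at_top. tail F (x / K) / tail F x < K powr \<alpha> + 1"
      by (rule order_tendstoD[OF ratio_limit_div[OF \<open>K > 0\<close>]]) simp
    then show "\<forall>\<^sub>F x in at_top. AE y in G. norm (h x y * indicator {..K} y) \<le> C * (K powr \<alpha> + 1)"
      using eventually_gt_at_top[of 0]
    proof eventually_elim
      case (elim x)
      have *: "C * (tail F (x / y) / tail F x) \<le> C * (K powr \<alpha> + 1)" if "0 < y" "y \<le> K" for y
      proof (intro mult_left_mono \<open>C \<ge> 0\<close>)
        have "tail F (x / y) / tail F x \<le> tail F (x / K) / tail F x"
          using that elim \<open>K > 0\<close> by (intro divide_right_mono F_antimono divide_left_mono) auto
        then show "tail F (x / y) / tail F x \<le> K powr \<alpha> + 1" using elim by simp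
      qed
      have "0 \<le> C * (K powr \<alpha> + 1)" using \<open>C \<ge> 0\<close> by simp
      show ?case using dom
      proof eventually_elim
        case (elim y)
        have "0 \<le> h x y" "h x y \<le> (if y > 0 then C * (tail F (x / y) / tail F x) else 0)"
          using elim by auto
        with *[of y] \<open>0 \<le> C * (K powr \<alpha> + 1)\<close> show ?case
          by (cases "y \<le> K"; cases "y > 0") auto
      qed
    qed
  qed (auto)
  have g_tail: "(\<integral>y. g y * indicator {K<..} y \<partial>G) \<in> {0..C * \<epsilon>}"
  proof -
    have "(\<integral>\<^sup>+y. ennreal (g y * indicator {K<..} y) \<partial>G) \<le> (\<integral>\<^sup>+y. ennreal C * (ennreal (y powr \<alpha>) * indicator {K<..} y) \<partial>G)"
      using g_bound by (intro nn_integral_mono_AE, elim eventually_mono)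
        (auto simp: indicator_def ennreal_mult''[symmetric] intro!: ennreal_leI)
    also have "\<dots> \<le> ennreal C * ennreal \<epsilon>"
      using K by (subst nn_integral_cmult) (auto intro: mult_left_mono)
    also have "\<dots> = ennreal (C * \<epsilon>)" using \<open>\<epsilon> > 0\<close> by (simp add: ennreal_mult'')
    also have "(\<integral>\<^sup>+y. ennreal (g y * indicator {K<..} y) \<partial>G) = ennreal (\<integral>y. g y * indicator {K<..} y \<partial>G)"
      using g_bound by (intro nn_integral_eq_integral integrable_real_mult_indicator g_int) (auto elim!: eventually_mono)
    finally have "(\<integral>y. g y * indicator {K<..} y \<partial>G) \<le> C * \<epsilon>"
      using \<open>C \<ge> 0\<close> \<open>\<epsilon> > 0\<close> by (simp add: ennreal_le_iff)
    moreover have "(\<integral>y. g y * indicator {K<..} y \<partial>G) \<ge> 0"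
      using g_bound by (intro integral_nonneg_AE) (auto elim!: eventually_mono)
    ultimately show ?thesis by simp
  qed
  have h_tail: "\<forall>\<^sub>F x in at_top. (\<integral>y. h x y * indicator {K<..} y \<partial>G) \<in> {0..C * \<epsilon>}"
    using K\<^sub>0
  proof eventually_elim
    case (elim x)
    have "(\<integral>\<^sup>+y. ennreal (h x y * indicator {K<..} y) \<partial>G) \<le>
      (\<integral>\<^sup>+y. ennreal (C / tail F x) * (ennreal (tail F (x / y)) * indicator {K\<^sub>0<..} y) \<partial>G)"
    proof (rule nn_integral_mono_AE)
      show "AE y in G. ennreal (h x y * indicator {K<..} y) \<le>
        ennreal (C / tail F x) * (ennreal (tail F (x / y)) * indicator {K\<^sub>0<..} y)"
        using dom
      proof eventually_elim
        case (elim y)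
        show ?case
        proof (cases "y > K")
          case True
          then have "h x y \<le> C / tail F x * tail F (x / y)"
            using elim \<open>K > 0\<close> by (auto dest!: spec[of _ x])
          then show ?thesis using True K(1)
            by (simp add: ennreal_mult''[symmetric] ennreal_leI)
        qed simp
      qed
    qed
    also have "\<dots> = ennreal (C / tail F x) * (\<integral>\<^sup>+y\<in>{K\<^sub>0<..}. ennreal (tail F (x / y)) \<partial>G)"
      by (rule nn_integral_cmult) auto
    also have "\<dots> \<le> ennreal (C / tail F x) * ennreal (\<epsilon> * tail F x)"
      using elim by (intro mult_left_mono) auto
    also have "\<dots> = ennreal (C * \<epsilon>)"
      using \<open>\<epsilon> > 0\<close> F_pos[of x] by (subst ennreal_mult''[symmetric]) (auto simp: field_simps)
    also have "(\<integral>\<^sup>+y. ennreal (h x y * indicator {K<..} y) \<partial>G) = ennreal (\<integral>y. h x y * indicator {K<..} y \<partial>G)"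
      using dom by (intro nn_integral_eq_integral integrable_real_mult_indicator h_int) (auto elim!: eventually_mono)
    finally have "(\<integral>y. h x y * indicator {K<..} y \<partial>G) \<le> C * \<epsilon>"
      using \<open>C \<ge> 0\<close> \<open>\<epsilon> > 0\<close> by (simp add: ennreal_le_iff)
    moreover have "(\<integral>y. h x y * indicator {K<..} y \<partial>G) \<ge> 0"
      using dom by (intro integral_nonneg_AE) (auto elim!: eventually_mono)
    ultimately show ?case by simp
  qed
  have "\<forall>\<^sub>F x in at_top. dist (\<integral>y. h x y * indicator {..K} y \<partial>G) (\<integral>y. g y * indicator {..K} y \<partial>G) < e / 2"
    using bounded_part \<open>e > 0\<close> by (intro tendstoD) auto
  with h_tail show "\<forall>\<^sub>F x in at_top. dist (\<integral>y. h x y \<partial>G) (\<integral>y. g y \<partial>G) < e"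
  proof eventually_elim
    case (elim x)
    then show ?case
      using g_tail C\<epsilon> unfolding split[OF h_int] split[OF g_int] dist_real_def atLeastAtMost_iff by linarith
  qed
qed

section \<open>A single big jump\<close>

lemma scaled_tail_limit:
  assumes "((\<lambda>t. tail A t / tail F t) \<longlongrightarrow> a) at_top" "l > 0"
  shows "((\<lambda>t. tail A (l * t) / tail F t) \<longlongrightarrow> a * l powr (-\<alpha>)) at_top"
proof -
  have "filterlim (\<lambda>t. l * t) at_top at_top"
    using \<open>l > 0\<close> by (intro filterlim_tendsto_pos_mult_at_top[OF tendsto_const]) (auto simp: filterlim_ident)
  then have "((\<lambda>t. tail A (l * t) / tail F (l * t)) \<longlongrightarrow> a) at_top"
    by (rule filterlim_compose[OF assms(1)])
  from tendsto_mult[OF this ratio_limit[OF \<open>l > 0\<close>]] show ?thesis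
    using F_pos by (simp add: mult.commute[of l] less_imp_neq[symmetric])
qed

lemma convolution_tail_eq:
  assumes A: "real_distribution A" and N: "real_distribution N"
  shows "(\<integral>u. tail N (t - u) \<partial>A) = measure (A \<Otimes>\<^sub>M N) {p. t < fst p + snd p}"
proof -
  interpret A: real_distribution A by fact
  interpret N: real_distribution N by fact
  interpret AN: pair_prob_space A N ..
  note [measurable] = A N
  have S: "{p. t < fst p + snd p} \<in> sets (A \<Otimes>\<^sub>M N)"
  proof -
    have "{p \<in> space (A \<Otimes>\<^sub>M N). t < fst p + snd p} \<in> sets (A \<Otimes>\<^sub>M N)" by measurable
    then show ?thesis by (simp add: space_pair_measure)
  qed
  have "emeasure (A \<Otimes>\<^sub>M N) {p. t < fst p + snd p} = (\<integral>\<^sup>+u. emeasure N (Pair u -` {p. t < fst p + snd p}) \<partial>A)"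
    by (rule N.emeasure_pair_measure_alt[OF S])
  also have "\<dots> = (\<integral>\<^sup>+u. ennreal (tail N (t - u)) \<partial>A)"
    by (intro nn_integral_cong)
       (auto simp: tail_def N.emeasure_eq_measure vimage_def algebra_simps intro!: arg_cong2[where f = measure])
  also have "\<dots> = ennreal (\<integral>u. tail N (t - u) \<partial>A)"
    by (intro nn_integral_eq_integral A.integrable_const_bound[where B = 1])
       (auto intro!: AE_I2 simp: tail_le_1[OF N])
  finally show ?thesis
    unfolding AN.emeasure_eq_measure by (subst (asm) ennreal_inj) auto
qed

text \<open>A sum exceeds a large level \<open>t\<close> essentially only if one summand does. For \<open>l < 1\<close> slightly below one, either a
summand exceeds \<open>l t\<close> or both exceed \<open>(1 - l) t\<close>, and the latter is of smaller order. For \<open>l > 1\<close> slightly above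
one, it suffices that a summand exceeds \<open>l t\<close> while the other is above \<open>-(l - 1) t\<close>. Both bounds tend to
\<open>(a + c) l\<^sup>-\<^sup>\<alpha>\<close>.\<close>
lemma convolution_tail_limit:
  assumes A: "real_distribution A" and N: "real_distribution N"
    and a: "((\<lambda>t. tail A t / tail F t) \<longlongrightarrow> a) at_top"
    and c: "((\<lambda>t. tail N t / tail F t) \<longlongrightarrow> c) at_top"
  shows "((\<lambda>t. (\<integral>u. tail N (t - u) \<partial>A) / tail F t) \<longlongrightarrow> a + c) at_top"
proof -
  interpret A: real_distribution A by fact
  interpret N: real_distribution N by fact
  interpret AN: pair_prob_space A N ..
  let ?P = "measure (A \<Otimes>\<^sub>M N)"
  let ?S = "\<lambda>t::real. {p. t < fst p + snd p}"
  have S: "?S t \<in> sets (A \<Otimes>\<^sub>M N)" for t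
  proof -
    have "{p \<in> space (A \<Otimes>\<^sub>M N). t < fst p + snd p} \<in> sets (A \<Otimes>\<^sub>M N)" by measurable
    then show ?thesis by (simp add: space_pair_measure)
  qed
  have rect: "?P (X \<times> Y) = measure A X * measure N Y" if "X \<in> sets borel" "Y \<in> sets borel" for X Y
    using that by (simp add: measure_def N.emeasure_pair_measure_Times enn2real_mult)
  have rect_sets: "X \<times> Y \<in> sets (A \<Otimes>\<^sub>M N)" if "X \<in> sets borel" "Y \<in> sets borel" for X Y
    using that by (intro pair_measureI) auto
  have A_UNIV: "measure A UNIV = 1" and N_UNIV: "measure N UNIV = 1"
    using A.prob_space N.prob_space by simp_all
  have upper: "?P (?S t) / tail F t \<le> tail A (l * t) / tail F t + tail N (l * t) / tail F t
      + tail A ((1 - l) * t) / tail F t * tail N ((1 - l) * t)" for t l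
  proof -
    have "?S t \<subseteq> ({l * t<..} \<times> UNIV \<union> UNIV \<times> {l * t<..}) \<union> {(1 - l) * t<..} \<times> {(1 - l) * t<..}"
      by (auto simp: algebra_simps)
    then have "?P (?S t) \<le> ?P (({l * t<..} \<times> UNIV \<union> UNIV \<times> {l * t<..}) \<union> {(1 - l) * t<..} \<times> {(1 - l) * t<..})"
      by (intro AN.finite_measure_mono sets.Un rect_sets) auto
    also have "\<dots> \<le> ?P ({l * t<..} \<times> UNIV) + ?P (UNIV \<times> {l * t<..}) + ?P ({(1 - l) * t<..} \<times> {(1 - l) * t<..})"
      by (intro order_trans[OF measure_Un_le] add_right_mono measure_Un_le sets.Un rect_sets) auto
    also have "\<dots> = tail A (l * t) + tail N (l * t) + tail A ((1 - l) * t) * tail N ((1 - l) * t)"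
      by (simp add: rect tail_def A_UNIV N_UNIV)
    finally show ?thesis using F_pos[of t] by (simp add: add_divide_distrib[symmetric] divide_right_mono)
  qed
  have lower: "tail A (l * t) / tail F t * tail N (- ((l - 1) * t)) + tail A (- ((l - 1) * t)) * (tail N (l * t) / tail F t)
      - tail A (l * t) / tail F t * tail N (l * t) \<le> ?P (?S t) / tail F t" if "t > 0" "l > 1" for t l
  proof -
    let ?R\<^sub>1 = "{l * t<..} \<times> {- ((l - 1) * t)<..}" and ?R\<^sub>2 = "{- ((l - 1) * t)<..} \<times> {l * t<..}"
    have "0 < (l - 1) * t" "0 < l * t" using that by auto
    then have "?R\<^sub>1 \<inter> ?R\<^sub>2 = {l * t<..} \<times> {l * t<..}" by auto
    then have "?P (?R\<^sub>1 \<union> ?R\<^sub>2) = ?P ?R\<^sub>1 + ?P ?R\<^sub>2 - ?P ({l * t<..} \<times> {l * t<..})"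
      by (subst AN.finite_measure_Union') (auto simp: rect_sets AN.finite_measure_Diff' Int_commute)
    also have "\<dots> = tail A (l * t) * tail N (- ((l - 1) * t)) + tail A (- ((l - 1) * t)) * tail N (l * t)
      - tail A (l * t) * tail N (l * t)"
      by (simp add: rect tail_def)
    finally have "tail A (l * t) * tail N (- ((l - 1) * t)) + tail A (- ((l - 1) * t)) * tail N (l * t)
      - tail A (l * t) * tail N (l * t) = ?P (?R\<^sub>1 \<union> ?R\<^sub>2)" ..
    also have "\<dots> \<le> ?P (?S t)"
      by (intro AN.finite_measure_mono S) (auto simp: algebra_simps)
    finally show ?thesis using F_pos[of t] divide_right_mono[of _ _ "tail F t"]
      by (fastforce simp: add_divide_distrib diff_divide_distrib)
  qed
  have at_top: "filterlim (\<lambda>t. l * t) at_top at_top" if "l > 0" for l :: real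
    using that by (intro filterlim_tendsto_pos_mult_at_top[OF tendsto_const]) (auto simp: filterlim_ident)
  have A0: "((\<lambda>t. tail A (l * t)) \<longlongrightarrow> 0) at_top" and N0: "((\<lambda>t. tail N (l * t)) \<longlongrightarrow> 0) at_top" if "l > 0" for l
    using at_top[OF that] by (auto intro: filterlim_compose tail_at_top A N)
  have A1: "((\<lambda>t. tail A (- (l * t))) \<longlongrightarrow> 1) at_top" and N1: "((\<lambda>t. tail N (- (l * t))) \<longlongrightarrow> 1) at_top" if "l > 0" for l
    using filterlim_compose[OF tail_at_bot[OF A]] filterlim_compose[OF tail_at_bot[OF N]]
      at_top[OF that, unfolded filterlim_uminus_at_top] by blast+
  have upper_lim: "((\<lambda>t. tail A (l * t) / tail F t + tail N (l * t) / tail F t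
      + tail A ((1 - l) * t) / tail F t * tail N ((1 - l) * t)) \<longlongrightarrow> (a + c) * l powr (-\<alpha>)) at_top"
    if "0 < l" "l < 1" for l
  proof -
    have "((\<lambda>t. tail A (l * t) / tail F t + tail N (l * t) / tail F t
      + tail A ((1 - l) * t) / tail F t * tail N ((1 - l) * t)) \<longlongrightarrow>
      a * l powr (-\<alpha>) + c * l powr (-\<alpha>) + a * (1 - l) powr (-\<alpha>) * 0) at_top"
      using that by (intro tendsto_add tendsto_mult scaled_tail_limit a c N0) auto
    then show ?thesis by (simp add: algebra_simps)
  qed
  have lower_lim: "((\<lambda>t. tail A (l * t) / tail F t * tail N (- ((l - 1) * t)) + tail A (- ((l - 1) * t)) * (tail N (l * t) / tail F t)
      - tail A (l * t) / tail F t * tail N (l * t)) \<longlongrightarrow> (a + c) * l powr (-\<alpha>)) at_top"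
    if "l > 1" for l
  proof -
    have "((\<lambda>t. tail A (l * t) / tail F t * tail N (- ((l - 1) * t)) + tail A (- ((l - 1) * t)) * (tail N (l * t) / tail F t)
      - tail A (l * t) / tail F t * tail N (l * t)) \<longlongrightarrow> a * l powr (-\<alpha>) * 1 + 1 * (c * l powr (-\<alpha>)) - a * l powr (-\<alpha>) * 0) at_top"
      using that by (intro tendsto_add tendsto_diff tendsto_mult scaled_tail_limit a c A1 N1 N0) auto
    then show ?thesis by (simp add: algebra_simps)
  qed
  have scale: "((\<lambda>l. (a + c) * l powr (-\<alpha>)) \<longlongrightarrow> a + c) (at 1)"
    by (auto intro!: tendsto_eq_intros)
  have "((\<lambda>t. ?P (?S t) / tail F t) \<longlongrightarrow> a + c) at_top"
  proof (rule order_tendstoI)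
    fix b assume "b > a + c"
    have "\<forall>\<^sub>F l in at_left 1. (a + c) * l powr (-\<alpha>) < b"
      using order_tendstoD(2)[OF scale \<open>b > a + c\<close>] unfolding eventually_at_split by blast
    moreover have "\<forall>\<^sub>F l in at_left 1. l \<in> {0<..<1::real}"
      by (rule eventually_at_left_real) simp
    ultimately have "\<forall>\<^sub>F l in at_left 1. (a + c) * l powr (-\<alpha>) < b \<and> l \<in> {0<..<1}"
      by (rule eventually_conj)
    then obtain l where l: "(a + c) * l powr (-\<alpha>) < b" "0 < l" "l < 1"
      using eventually_happens'[OF trivial_limit_at_left_real] by fastforce
    from order_tendstoD(2)[OF upper_lim[OF l(2,3)] l(1)]
    show "\<forall>\<^sub>F t in at_top. ?P (?S t) / tail F t < b"
      by eventually_elim (rule le_less_trans[OF upper])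
  next
    fix b assume "b < a + c"
    have "\<forall>\<^sub>F l in at_right 1. (a + c) * l powr (-\<alpha>) > b"
      using order_tendstoD(1)[OF scale \<open>b < a + c\<close>] unfolding eventually_at_split by blast
    moreover have "\<forall>\<^sub>F l in at_right 1. l \<in> {1<..<2::real}"
      by (rule eventually_at_right_real) simp
    ultimately have "\<forall>\<^sub>F l in at_right 1. (a + c) * l powr (-\<alpha>) > b \<and> l \<in> {1<..<2}"
      by (rule eventually_conj)
    then obtain l where l: "(a + c) * l powr (-\<alpha>) > b" "1 < l"
      using eventually_happens'[OF trivial_limit_at_right_real] by fastforce
    from order_tendstoD(1)[OF lower_lim[OF l(2)] l(1)] eventually_gt_at_top[of 0]
    show "\<forall>\<^sub>F t in at_top. ?P (?S t) / tail F t > b"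
      by eventually_elim (rule less_le_trans[OF _ lower], use l in auto)
  qed
  then show ?thesis by (simp add: convolution_tail_eq[OF A N])
qed

section \<open>One discounted step\<close>

lemma convolution_tail_bound:
  assumes N: "real_distribution N" and c: "((\<lambda>t. tail N t / tail F t) \<longlongrightarrow> c) at_top"
  obtains C where "C \<ge> 0" "\<And>t. (\<integral>u. tail N (t - u) \<partial>F) \<le> C * tail F t"
proof -
  let ?J = "\<lambda>t. \<integral>u. tail N (t - u) \<partial>F"
  note [measurable] = N dist_F
  have "((\<lambda>t. tail F t / tail F t) \<longlongrightarrow> 1) at_top"
    using F_pos by (simp add: less_imp_neq[symmetric])
  from convolution_tail_limit[OF dist_F N this c]
  have "\<forall>\<^sub>F t in at_top. ?J t / tail F t < 1 + c + 1"
    by (rule order_tendstoD) simp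
  then obtain z where z: "\<And>t. t \<ge> z \<Longrightarrow> ?J t / tail F t < 1 + c + 1"
    by (auto simp: eventually_at_top_linorder)
  have J_le_1: "?J t \<le> 1" for t
    by (intro integral_le_const integrable_const_bound[where B = 1]) (auto simp: tail_le_1[OF N])
  define C where "C = max (c + 2) (1 / tail F z)"
  show ?thesis
  proof (rule that[of C])
    show "0 \<le> C" using F_pos[of z] by (simp add: C_def le_max_iff_disj)
    fix t
    show "?J t \<le> C * tail F t"
    proof (cases "t \<ge> z")
      case True
      then have "?J t \<le> (c + 2) * tail F t" using z[of t] F_pos[of t] by (simp add: field_simps)
      also have "\<dots> \<le> C * tail F t" by (intro mult_right_mono) (auto simp: C_def)
      finally show ?thesis .
    next
      case False
      have "?J t \<le> 1 / tail F z * tail F z" using J_le_1 F_pos[of z] by simp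
      also have "\<dots> \<le> C * tail F t"
        using False F_pos[of z] by (intro mult_mono F_antimono) (auto simp: C_def le_max_iff_disj)
      finally show ?thesis .
    qed
  qed
qed

lemma reweighted_distribution:
  assumes [measurable]: "w \<in> borel_measurable borel"
    and "AE u in F. 0 \<le> w u \<and> w u \<le> B" and "(\<integral>u. w u \<partial>F) = 1"
  shows "real_distribution (density F (\<lambda>u. ennreal (w u)))"
proof -
  note [measurable] = dist_F
  have "integrable F w"
  proof (rule integrable_const_bound[where B = B])
    show "AE u in F. norm (w u) \<le> B" using assms(2) by eventually_elim auto
  qed simp
  then have "(\<integral>\<^sup>+u. ennreal (w u) \<partial>F) = 1"
    using assms(2,3) by (subst nn_integral_eq_integral) (auto elim!: eventually_mono)
  then have "prob_space (density F (\<lambda>u. ennreal (w u)))"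
    by (intro prob_spaceI) (auto simp: emeasure_density space_density cong: nn_integral_cong)
  then show ?thesis
    unfolding real_distribution_def real_distribution_axioms_def by simp
qed

lemma reweighted_tail_limit:
  assumes [measurable]: "w \<in> borel_measurable borel"
    and bound: "AE u in F. 0 \<le> w u \<and> w u \<le> B" and lim: "(w \<longlongrightarrow> a) at_top"
  shows "((\<lambda>t. tail (density F (\<lambda>u. ennreal (w u))) t / tail F t) \<longlongrightarrow> a) at_top"
proof (rule tendstoI)
  note [measurable] = dist_F
  have int: "integrable F w"
  proof (rule integrable_const_bound[where B = B])
    show "AE u in F. norm (w u) \<le> B" using bound by eventually_elim auto
  qed simp
  have tail_eq: "tail (density F (\<lambda>u. ennreal (w u))) t = (\<integral>u. w u * indicator {t<..} u \<partial>F)" for t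
  proof -
    have "emeasure (density F (\<lambda>u. ennreal (w u))) {t<..} = (\<integral>\<^sup>+u. ennreal (w u * indicator {t<..} u) \<partial>F)"
      by (subst emeasure_density) (auto simp: indicator_def intro!: nn_integral_cong)
    also have "\<dots> = ennreal (\<integral>u. w u * indicator {t<..} u \<partial>F)"
      using bound by (intro nn_integral_eq_integral integrable_real_mult_indicator int) (auto elim!: eventually_mono)
    finally show ?thesis unfolding tail_def
      using bound by (intro measure_eq_emeasure_eq_ennreal integral_nonneg_AE) (auto elim!: eventually_mono)
  qed
  fix e :: real assume "e > 0"
  have "\<forall>\<^sub>F t in at_top. dist (w t) a < e / 2"
    using lim \<open>e > 0\<close> by (intro tendstoD) auto
  then obtain z where z: "\<And>t. t \<ge> z \<Longrightarrow> dist (w t) a < e / 2"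
    by (auto simp: eventually_at_top_linorder)
  show "\<forall>\<^sub>F t in at_top. dist (tail (density F (\<lambda>u. ennreal (w u))) t / tail F t) a < e"
    using eventually_ge_at_top[of z]
  proof eventually_elim
    case (elim t)
    have int_t: "integrable F (\<lambda>u. w u * indicator {t<..} u)" "integrable F (\<lambda>u. a * indicator {t<..} u)"
      by (intro integrable_real_mult_indicator int; simp)
         (intro integrable_mult_right integrable_real_indicator; simp add: emeasure_eq_measure)
    have "\<bar>tail (density F (\<lambda>u. ennreal (w u))) t - a * tail F t\<bar> = \<bar>\<integral>u. w u * indicator {t<..} u - a * indicator {t<..} u \<partial>F\<bar>"
      using int_t by (subst Bochner_Integration.integral_diff) (auto simp: tail_eq tail_def[of F])
    also have "\<dots> \<le> (\<integral>u. \<bar>w u * indicator {t<..} u - a * indicator {t<..} u\<bar> \<partial>F)"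
      by (rule integral_abs_bound)
    also have "\<dots> \<le> (\<integral>u. e / 2 * indicator {t<..} u \<partial>F)"
    proof (rule integral_mono)
      show "integrable F (\<lambda>u. \<bar>w u * indicator {t<..} u - a * indicator {t<..} u\<bar>)"
        by (intro integrable_abs Bochner_Integration.integrable_diff int_t)
      show "integrable F (\<lambda>u. e / 2 * indicator {t<..} u)"
        by (intro integrable_mult_right integrable_real_indicator) (auto simp: emeasure_eq_measure)
      show "\<bar>w u * indicator {t<..} u - a * indicator {t<..} u\<bar> \<le> e / 2 * indicator {t<..} u" for u
        using z[of u] elim by (cases "u > t") (auto simp: dist_real_def)
    qed
    also have "\<dots> = e / 2 * tail F t" by (simp add: tail_def)
    finally have "\<bar>tail (density F (\<lambda>u. ennreal (w u))) t - a * tail F t\<bar> / tail F t \<le> e / 2"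
      using F_pos[of t] by (simp add: field_simps)
    moreover have "tail (density F (\<lambda>u. ennreal (w u))) t / tail F t - a =
      (tail (density F (\<lambda>u. ennreal (w u))) t - a * tail F t) / tail F t"
      using F_pos[of t] by (simp add: field_simps)
    ultimately have "dist (tail (density F (\<lambda>u. ennreal (w u))) t / tail F t) a \<le> e / 2"
      using F_pos[of t] by (simp add: dist_real_def)
    then show ?case using \<open>e > 0\<close> by linarith
  qed
qed

text \<open>Here \<open>q u y\<close> is the density of the joint law of \<open>(X, Y)\<close> with respect to the product of its marginals, and
\<open>N\<close> is the law of an independent variable \<open>W\<close>; the measure on the left is \<open>P(Y (X + W) > x)\<close>. Given \<open>Y = y > 0\<close>,
the event is \<open>X + W > x / y\<close>, whose probability \<open>H (x / y) y\<close> is at most \<open>B P(X' + W > x / y)\<close> for an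
\<open>X'\<close> of law \<open>F\<close> independent of \<open>W\<close>. This supplies the domination that passing to the limit under the integral
over \<open>y\<close> requires.\<close>
lemma randomly_discounted_sum_tail:
  assumes G: "real_distribution G" and N: "real_distribution N"
    and neg: "large_factor_negligible F G"
    and moment: "integrable G (\<lambda>y. y powr \<alpha>)"
    and nonneg: "AE y in G. y \<ge> 0"
    and q[measurable]: "(\<lambda>(u, y). q u y) \<in> borel_measurable (borel \<Otimes>\<^sub>M borel)"
    and r[measurable]: "r \<in> borel_measurable borel"
    and B: "B \<ge> 0" and bound: "AE y in G. AE u in F. 0 \<le> q u y \<and> q u y \<le> B"
    and mass: "AE y in G. (\<integral>u. q u y \<partial>F) = 1"
    and lim: "AE y in G. ((\<lambda>u. q u y) \<longlongrightarrow> r y) at_top"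
    and c: "((\<lambda>t. tail N t / tail F t) \<longlongrightarrow> c) at_top"
  shows "((\<lambda>x. measure (density (F \<Otimes>\<^sub>M G) (\<lambda>(u, y). ennreal (q u y)) \<Otimes>\<^sub>M N)
        {p. x < snd (fst p) * (fst (fst p) + snd p)} / tail F x)
      \<longlongrightarrow> (\<integral>y. (r y + c) * y powr \<alpha> \<partial>G)) at_top"
proof -
  interpret G: real_distribution G by fact
  interpret N: real_distribution N by fact
  interpret FG: pair_prob_space F G ..
  note [measurable] = dist_F G N
  let ?D = "density (F \<Otimes>\<^sub>M G) (\<lambda>(u, y). ennreal (q u y))"
  let ?S = "\<lambda>x::real. {p::(real \<times> real) \<times> real. x < snd (fst p) * (fst (fst p) + snd p)}"
  define H where "H = (\<lambda>t y. \<integral>u. q u y * tail N (t - u) \<partial>F)"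
  have q1[measurable]: "(\<lambda>u. q u y) \<in> borel_measurable borel" for y
    using measurable_compose[OF measurable_Pair2' q, of y] by simp
  have int_q: "integrable F (\<lambda>u. q u y * tail N (t - u))" if "AE u in F. 0 \<le> q u y \<and> q u y \<le> B" for y t
    using that
  proof (intro integrable_const_bound[where B = B], elim eventually_mono)
    fix u assume "0 \<le> q u y \<and> q u y \<le> B"
    then have "\<bar>q u y\<bar> * tail N (t - u) \<le> B * 1"
      by (intro mult_mono tail_le_1[OF N]) auto
    then show "norm (q u y * tail N (t - u)) \<le> B" by (simp add: abs_mult)
  qed simp
  obtain C where C: "C \<ge> 0" "\<And>t. (\<integral>u. tail N (t - u) \<partial>F) \<le> C * tail F t"
    using convolution_tail_bound[OF N c] by blast
  have H_bound: "AE y in G. \<forall>t. 0 \<le> H t y \<and> H t y \<le> B * C * tail F t"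
    using bound
  proof eventually_elim
    case (elim y)
    show ?case
    proof (intro allI conjI)
      fix t
      show "0 \<le> H t y" unfolding H_def
        using elim by (intro integral_nonneg_AE) (auto elim!: eventually_mono)
      have "H t y \<le> (\<integral>u. B * tail N (t - u) \<partial>F)" unfolding H_def
      proof (rule integral_mono_AE[OF int_q[OF elim]])
        show "integrable F (\<lambda>u. B * tail N (t - u))"
          by (intro integrable_mult_right integrable_const_bound[where B = 1]) (auto simp: tail_le_1[OF N])
        show "AE u in F. q u y * tail N (t - u) \<le> B * tail N (t - u)"
          using elim by eventually_elim (auto intro!: mult_right_mono)
      qed
      also have "\<dots> \<le> B * (C * tail F t)"
        using C(2)[of t] B by (simp add: mult_left_mono)
      finally show "H t y \<le> B * C * tail F t" by (simp add: mult.assoc)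
    qed
  qed
  have H_lim: "AE y in G. ((\<lambda>t. H t y / tail F t) \<longlongrightarrow> r y + c) at_top"
    using bound mass lim
  proof eventually_elim
    case (elim y)
    let ?A = "density F (\<lambda>u. ennreal (q u y))"
    have "H t y = (\<integral>u. tail N (t - u) \<partial>?A)" for t
      unfolding H_def using elim(1) by (subst integral_density) (auto elim!: eventually_mono)
    then show ?case
      using convolution_tail_limit[OF reweighted_distribution[OF q1 elim(1,2)] N reweighted_tail_limit[OF q1 elim(1,3)] c]
      by simp
  qed
  define h where "h = (\<lambda>x y. (if y > 0 then H (x / y) y else 0) / tail F x)"
  have H_meas[measurable]: "(\<lambda>y. H (x / y) y) \<in> borel_measurable borel" for x
    unfolding H_def by measurable
  have h_meas[measurable]: "h x \<in> borel_measurable borel" for x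
    unfolding h_def by measurable
  have h_dom: "AE y in G. \<forall>x. 0 \<le> h x y \<and> h x y \<le> (if y > 0 then B * C * (tail F (x / y) / tail F x) else 0)"
    using H_bound
  proof eventually_elim
    case (elim y)
    then show ?case using F_pos by (auto simp: h_def divide_right_mono less_imp_le)
  qed
  have h_lim: "AE y in G. ((\<lambda>x. h x y) \<longlongrightarrow> (r y + c) * y powr \<alpha>) at_top"
    using H_lim nonneg
  proof eventually_elim
    case (elim y)
    show ?case
    proof (cases "y > 0")
      case True
      have "filterlim (\<lambda>x. x / y) at_top at_top"
        using filterlim_tendsto_pos_mult_at_top[OF tendsto_const[of "inverse y"] _ filterlim_ident] True
        by (simp add: divide_inverse mult.commute)
      then have "((\<lambda>x. H (x / y) y / tail F (x / y)) \<longlongrightarrow> r y + c) at_top"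
        by (rule filterlim_compose[OF elim(1)])
      from tendsto_mult[OF this ratio_limit_div[OF True]] show ?thesis
        using True F_pos by (simp add: h_def less_imp_neq[symmetric])
    next
      case False
      then have "y = 0" using elim by simp
      then show ?thesis by (simp add: h_def)
    qed
  qed
  have main: "((\<lambda>x. \<integral>y. h x y \<partial>G) \<longlongrightarrow> (\<integral>y. (r y + c) * y powr \<alpha> \<partial>G)) at_top"
    by (rule dominated_breiman_limit[OF G neg moment _ _ _ h_dom h_lim]) (use B C in auto)
  have "\<forall>\<^sub>F x in at_top. (\<integral>y. h x y \<partial>G) = measure (?D \<Otimes>\<^sub>M N) (?S x) / tail F x"
    using eventually_gt_at_top[of 0]
  proof eventually_elim
    case (elim x)
    have S_meas: "?S x \<in> sets (?D \<Otimes>\<^sub>M N)"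
    proof -
      have "{p \<in> space (?D \<Otimes>\<^sub>M N). x < snd (fst p) * (fst (fst p) + snd p)} \<in> sets (?D \<Otimes>\<^sub>M N)"
        by measurable
      then show ?thesis by (simp add: space_pair_measure)
    qed
    have S_meas': "?S x \<in> sets ((F \<Otimes>\<^sub>M G) \<Otimes>\<^sub>M N)"
      using S_meas by (simp cong: sets_pair_measure_cong)
    have [measurable]: "(\<lambda>p. emeasure N (Pair p -` ?S x)) \<in> borel_measurable (F \<Otimes>\<^sub>M G)"
      by (rule N.measurable_emeasure_Pair[OF S_meas'])
    have "emeasure (?D \<Otimes>\<^sub>M N) (?S x) = (\<integral>\<^sup>+p. emeasure N (Pair p -` ?S x) \<partial>?D)"
      by (rule N.emeasure_pair_measure_alt[OF S_meas])
    also have "\<dots> = (\<integral>\<^sup>+p. (case p of (u, y) \<Rightarrow> ennreal (q u y)) * emeasure N (Pair p -` ?S x) \<partial>(F \<Otimes>\<^sub>M G))"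
      by (rule nn_integral_density) auto
    also have "\<dots> = (\<integral>\<^sup>+y. \<integral>\<^sup>+u. ennreal (q u y) * emeasure N (Pair (u, y) -` ?S x) \<partial>F \<partial>G)"
      by (subst FG.nn_integral_snd[symmetric]) auto
    also have "\<dots> = (\<integral>\<^sup>+y. ennreal (if y > 0 then H (x / y) y else 0) \<partial>G)"
    proof (rule nn_integral_cong_AE)
      show "AE y in G. (\<integral>\<^sup>+u. ennreal (q u y) * emeasure N (Pair (u, y) -` ?S x) \<partial>F) = ennreal (if y > 0 then H (x / y) y else 0)"
        using nonneg bound
      proof eventually_elim
        case (elim y)
        show ?case
        proof (cases "y > 0")
          case True
          have "Pair (u, y) -` ?S x = {x / y - u<..}" for u
            using True by (auto simp: field_simps)
          then have "(\<integral>\<^sup>+u. ennreal (q u y) * emeasure N (Pair (u, y) -` ?S x) \<partial>F) =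
              (\<integral>\<^sup>+u. ennreal (q u y * tail N (x / y - u)) \<partial>F)"
            by (simp add: tail_def N.emeasure_eq_measure ennreal_mult'')
          also have "\<dots> = ennreal (H (x / y) y)" unfolding H_def
            using elim(2) by (intro nn_integral_eq_integral int_q) (auto elim!: eventually_mono)
          finally show ?thesis using True by simp
        next
          case False
          then have "y = 0" using elim by simp
          then have "Pair (u, y) -` ?S x = {}" for u using \<open>0 < x\<close> by auto
          then show ?thesis using False by simp
        qed
      qed
    qed
    also have "\<dots> = ennreal (\<integral>y. (if y > 0 then H (x / y) y else 0) \<partial>G)"
    proof (rule nn_integral_eq_integral)
      show "integrable G (\<lambda>y. if y > 0 then H (x / y) y else 0)"
      proof (rule G.integrable_const_bound[where B = "B * C"])
        show "AE y in G. norm (if y > 0 then H (x / y) y else 0) \<le> B * C"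
          using H_bound
        proof eventually_elim
          case (elim y)
          have "H (x / y) y \<le> B * C * tail F (x / y)" "0 \<le> H (x / y) y" using elim by auto
          moreover have "B * C * tail F (x / y) \<le> B * C * 1"
            using B C(1) by (intro mult_left_mono F_le_1) auto
          ultimately show ?case using B C(1) by auto
        qed
      qed simp
      show "AE y in G. 0 \<le> (if y > 0 then H (x / y) y else 0)"
        using H_bound by (elim eventually_mono) auto
    qed
    finally have "measure (?D \<Otimes>\<^sub>M N) (?S x) = (\<integral>y. (if y > 0 then H (x / y) y else 0) \<partial>G)"
      using H_bound by (intro measure_eq_emeasure_eq_ennreal integral_nonneg_AE) (auto elim!: eventually_mono)
    then show ?case unfolding h_def by simp
  qed
  from Lim_transform_eventually[OF main this] show ?thesis .
qed

end

section \<open>The Sarmanov kernel\<close>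

text \<open>Each point outside the support lies in one of the countably many null intervals with rational end points.\<close>
lemma AE_law_support:
  assumes "real_distribution \<mu>"
  shows "AE x in \<mu>. x \<in> law_support \<mu>"
proof -
  interpret real_distribution \<mu> by fact
  define I where "I = {p \<in> \<rat> \<times> \<rat>. measure \<mu> {fst p<..<snd p :: real} = 0}"
  have "countable I" unfolding I_def
    by (rule countable_subset[of _ "\<rat> \<times> \<rat>"]) (auto simp: countable_rat)
  moreover have "AE x in \<mu>. x \<notin> {fst p<..<snd p}" if "p \<in> I" for p
    using that by (intro AE_not_in) (auto simp: I_def null_sets_def emeasure_eq_measure)
  ultimately have "AE x in \<mu>. \<forall>p\<in>I. x \<notin> {fst p<..<snd p}"
    by (simp add: AE_ball_countable)
  then show ?thesis
  proof eventually_elim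
    case (elim x)
    show ?case unfolding law_support_def
    proof (clarify, rule ccontr)
      fix e :: real assume "e > 0" "\<not> measure \<mu> (ball x e) > 0"
      then have 0: "measure \<mu> (ball x e) = 0" by (simp add: zero_less_measure_iff)
      obtain a where a: "a \<in> \<rat>" "x - e < a" "a < x" using Rats_dense_in_real[of "x - e" x] \<open>e > 0\<close> by auto
      obtain b where b: "b \<in> \<rat>" "x < b" "b < x + e" using Rats_dense_in_real[of x "x + e"] \<open>e > 0\<close> by auto
      have "measure \<mu> {a<..<b} \<le> measure \<mu> (ball x e)"
        using a b by (intro finite_measure_mono) (auto simp: dist_real_def)
      then have "(a, b) \<in> I" using 0 a b measure_nonneg[of \<mu> "{a<..<b}"] by (auto simp: I_def)
      then show False using elim a b by auto
    qed
  qed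
qed

lemma mean_zero_takes_positive_value:
  fixes \<phi> :: "real \<Rightarrow> real"
  assumes "integrable \<mu> \<phi>" "(\<integral>x. \<phi> x \<partial>\<mu>) = 0" "AE x in \<mu>. x \<in> S" "\<not> (AE x in \<mu>. \<phi> x = 0)"
  shows "\<exists>x\<in>S. \<phi> x > 0"
proof (rule ccontr)
  assume "\<not> ?thesis"
  then have "AE x in \<mu>. 0 \<le> - \<phi> x"
    using assms(3) by (auto elim!: eventually_mono simp: not_less)
  then have "AE x in \<mu>. - \<phi> x = 0"
    using integral_nonneg_eq_0_iff_AE[of \<mu> "\<lambda>x. - \<phi> x"] assms by simp
  with assms(4) show False by simp
qed

text \<open>A nontrivial \<open>\<phi>\<close> of mean zero takes a positive and a negative value; nonnegativity of
\<open>1 + \<phi> x * \<psi> y\<close> at these two points bounds \<open>\<psi> y\<close> from below and from above.\<close>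
lemma kernel_bounded:
  fixes \<phi> :: "real \<Rightarrow> real"
  assumes "integrable \<mu> \<phi>" "(\<integral>x. \<phi> x \<partial>\<mu>) = 0" "AE x in \<mu>. x \<in> S" "\<not> (AE x in \<mu>. \<phi> x = 0)"
    and pos: "\<And>x y. x \<in> S \<Longrightarrow> y \<in> T \<Longrightarrow> 1 + \<phi> x * \<psi> y \<ge> (0::real)"
  obtains b where "b \<ge> 0" "\<And>y. y \<in> T \<Longrightarrow> \<bar>\<psi> y\<bar> \<le> b"
proof -
  obtain p where p: "p \<in> S" "\<phi> p > 0"
    using mean_zero_takes_positive_value[OF assms(1-4)] by blast
  have "\<exists>x\<in>S. - \<phi> x > 0"
    using assms(1-4) by (intro mean_zero_takes_positive_value[of \<mu>]) auto
  then obtain p' where p': "p' \<in> S" "\<phi> p' < 0" by auto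
  show ?thesis
  proof (rule that[of "1 / \<phi> p + 1 / (- \<phi> p')"])
    show "0 \<le> 1 / \<phi> p + 1 / (- \<phi> p')" using p p' by (intro add_nonneg_nonneg) (auto simp: divide_nonpos_neg)
    fix y assume y: "y \<in> T"
    have "- (1 / \<phi> p) \<le> \<psi> y" using pos[OF p(1) y] p(2) by (simp add: field_simps)
    moreover have "\<psi> y \<le> 1 / (- \<phi> p')" using pos[OF p'(1) y] p'(2) by (simp add: field_simps)
    moreover have "0 \<le> 1 / \<phi> p" "0 \<le> 1 / (- \<phi> p')" using p p' by (auto simp: divide_nonpos_neg)
    ultimately show "\<bar>\<psi> y\<bar> \<le> 1 / \<phi> p + 1 / (- \<phi> p')" by linarith
  qed
qed

text \<open>The properties of the joint density used in a discounted step. Passing to an abstract density \<open>q\<close> allows it to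
be changed on a null set: if one of the kernels vanishes almost everywhere, the other one need not be bounded, but
\<open>q\<close> may be taken to be \<open>1\<close>.\<close>
definition kernel_domination :: "real measure \<Rightarrow> real measure \<Rightarrow> (real \<Rightarrow> real \<Rightarrow> real) \<Rightarrow> (real \<Rightarrow> real) \<Rightarrow> real \<Rightarrow> bool" where
  "kernel_domination F G q r B \<longleftrightarrow>
    (\<lambda>(u, y). q u y) \<in> borel_measurable (borel \<Otimes>\<^sub>M borel) \<and> r \<in> borel_measurable borel \<and> B \<ge> 0 \<and>
    (AE y in G. AE u in F. 0 \<le> q u y \<and> q u y \<le> B) \<and>
    (AE y in G. (\<integral>u. q u y \<partial>F) = 1) \<and>
    (AE y in G. ((\<lambda>u. q u y) \<longlongrightarrow> r y) at_top)"

context regularly_varying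
begin

text \<open>If \<open>\<phi>\<^sub>1\<close> vanishes almost everywhere, then it does so at arbitrarily large arguments, since no tail of \<open>F\<close> is
null; hence \<open>d\<^sub>1 = 0\<close>. This makes the product with the integral vanish even if \<open>\<phi>\<^sub>2(y) y\<^sup>\<alpha>\<close> is not integrable.\<close>
lemma sarmanov_degenerate:
  fixes \<phi>\<^sub>1 \<phi>\<^sub>2 :: "real \<Rightarrow> real"
  assumes G: "real_distribution G"
    and [measurable]: "\<phi>\<^sub>1 \<in> borel_measurable borel" "\<phi>\<^sub>2 \<in> borel_measurable borel"
    and lim: "(\<phi>\<^sub>1 \<longlongrightarrow> d\<^sub>1) at_top"
    and deg: "\<theta> = 0 \<or> (AE u in F. \<phi>\<^sub>1 u = 0) \<or> (AE y in G. \<phi>\<^sub>2 y = 0)"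
  shows "density (F \<Otimes>\<^sub>M G) (\<lambda>(u, y). ennreal (1 + \<theta> * \<phi>\<^sub>1 u * \<phi>\<^sub>2 y)) = density (F \<Otimes>\<^sub>M G) (\<lambda>(u, y). ennreal 1)"
    and "\<theta> * d\<^sub>1 * (\<integral>y. \<phi>\<^sub>2 y * y powr \<alpha> \<partial>G) = 0"
proof -
  interpret G: real_distribution G by fact
  interpret FG: pair_prob_space F G ..
  note [measurable] = dist_F G
  have "AE p in F \<Otimes>\<^sub>M G. \<theta> * \<phi>\<^sub>1 (fst p) * \<phi>\<^sub>2 (snd p) = 0"
  proof (rule FG.AE_pair_measure)
    show "{p \<in> space (F \<Otimes>\<^sub>M G). \<theta> * \<phi>\<^sub>1 (fst p) * \<phi>\<^sub>2 (snd p) = 0} \<in> sets (F \<Otimes>\<^sub>M G)"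
      by measurable
    show "AE u in F. AE y in G. \<theta> * \<phi>\<^sub>1 (fst (u, y)) * \<phi>\<^sub>2 (snd (u, y)) = 0"
      using deg
    proof (elim disjE)
      assume "AE u in F. \<phi>\<^sub>1 u = 0"
      then show ?thesis by eventually_elim simp
    next
      assume "AE y in G. \<phi>\<^sub>2 y = 0"
      then have "AE y in G. \<theta> * \<phi>\<^sub>1 (fst (u, y)) * \<phi>\<^sub>2 (snd (u, y)) = 0" for u by eventually_elim simp
      then show ?thesis by simp
    qed simp
  qed
  then show "density (F \<Otimes>\<^sub>M G) (\<lambda>(u, y). ennreal (1 + \<theta> * \<phi>\<^sub>1 u * \<phi>\<^sub>2 y)) = density (F \<Otimes>\<^sub>M G) (\<lambda>(u, y). ennreal 1)"
    by (intro density_cong) (auto elim!: eventually_mono)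
  show "\<theta> * d\<^sub>1 * (\<integral>y. \<phi>\<^sub>2 y * y powr \<alpha> \<partial>G) = 0"
    using deg
  proof (elim disjE)
    assume *: "AE u in F. \<phi>\<^sub>1 u = 0"
    have "d\<^sub>1 = 0"
    proof (rule ccontr)
      assume "d\<^sub>1 \<noteq> 0"
      then have "\<forall>\<^sub>F u in at_top. \<phi>\<^sub>1 u \<noteq> 0" using lim by (rule tendsto_imp_eventually_ne[rotated])
      then obtain z where z: "\<And>u. u \<ge> z \<Longrightarrow> \<phi>\<^sub>1 u \<noteq> 0" by (auto simp: eventually_at_top_linorder)
      have "AE u in F. u \<notin> {z<..}" using * by eventually_elim (use z in \<open>auto dest: less_imp_le\<close>)
      then have "emeasure F {z<..} = 0" by (subst (asm) AE_iff_measurable[of "{z<..}"]) auto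
      then show False using F_pos[of z] by (simp add: tail_def measure_def)
    qed
    then show ?thesis by simp
  next
    assume "AE y in G. \<phi>\<^sub>2 y = 0"
    then have "AE y in G. \<phi>\<^sub>2 y * y powr \<alpha> = 0" by eventually_elim simp
    then have "(\<integral>y. \<phi>\<^sub>2 y * y powr \<alpha> \<partial>G) = 0" by (rule integral_eq_zero_AE)
    then show ?thesis by simp
  qed simp
qed

lemma sarmanov_kernel:
  fixes \<phi>\<^sub>1 \<phi>\<^sub>2 :: "real \<Rightarrow> real"
  assumes G: "real_distribution G"
    and meas[measurable]: "\<phi>\<^sub>1 \<in> borel_measurable borel" "\<phi>\<^sub>2 \<in> borel_measurable borel"
    and \<phi>\<^sub>1: "integrable F \<phi>\<^sub>1" "(\<integral>u. \<phi>\<^sub>1 u \<partial>F) = 0"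
    and \<phi>\<^sub>2: "integrable G \<phi>\<^sub>2" "(\<integral>y. \<phi>\<^sub>2 y \<partial>G) = 0"
    and pos: "\<forall>x\<in>law_support F. \<forall>y\<in>law_support G. 1 + \<theta> * \<phi>\<^sub>1 x * \<phi>\<^sub>2 y \<ge> 0"
    and lim: "(\<phi>\<^sub>1 \<longlongrightarrow> d\<^sub>1) at_top"
    and moment: "integrable G (\<lambda>y. y powr \<alpha>)"
  obtains q r B where "kernel_domination F G q r B"
    "density (F \<Otimes>\<^sub>M G) (\<lambda>(u, y). ennreal (1 + \<theta> * \<phi>\<^sub>1 u * \<phi>\<^sub>2 y)) = density (F \<Otimes>\<^sub>M G) (\<lambda>(u, y). ennreal (q u y))"
    "\<And>c. (\<integral>y. (r y + c) * y powr \<alpha> \<partial>G) =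
      (\<integral>y. y powr \<alpha> \<partial>G) + \<theta> * d\<^sub>1 * (\<integral>y. \<phi>\<^sub>2 y * y powr \<alpha> \<partial>G) + c * (\<integral>y. y powr \<alpha> \<partial>G)"
proof -
  interpret G: real_distribution G by fact
  note [measurable] = dist_F G
  have mass_1: "measure F UNIV = 1" using prob_space by simp
  show thesis
  proof (cases "\<theta> = 0 \<or> (AE u in F. \<phi>\<^sub>1 u = 0) \<or> (AE y in G. \<phi>\<^sub>2 y = 0)")
    case True
    note deg = sarmanov_degenerate[OF G meas lim True]
    show ?thesis
    proof (rule that[of "\<lambda>_ _. 1" "\<lambda>_. 1" 1])
      show "kernel_domination F G (\<lambda>_ _. 1) (\<lambda>_. 1) 1"
        by (simp add: kernel_domination_def mass_1)
      show "density (F \<Otimes>\<^sub>M G) (\<lambda>(u, y). ennreal (1 + \<theta> * \<phi>\<^sub>1 u * \<phi>\<^sub>2 y)) = density (F \<Otimes>\<^sub>M G) (\<lambda>(u, y). ennreal 1)"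
        by (rule deg)
      show "(\<integral>y. (1 + c) * y powr \<alpha> \<partial>G) =
        (\<integral>y. y powr \<alpha> \<partial>G) + \<theta> * d\<^sub>1 * (\<integral>y. \<phi>\<^sub>2 y * y powr \<alpha> \<partial>G) + c * (\<integral>y. y powr \<alpha> \<partial>G)" for c
        unfolding deg(2) using moment by (simp add: distrib_right)
    qed
  next
    case False
    let ?q = "\<lambda>u y. 1 + \<theta> * \<phi>\<^sub>1 u * \<phi>\<^sub>2 y"
    have \<theta>: "\<theta> \<noteq> 0" using False by simp
    obtain b\<^sub>2 where b\<^sub>2: "b\<^sub>2 \<ge> 0" "\<And>y. y \<in> law_support G \<Longrightarrow> \<bar>\<theta> * \<phi>\<^sub>2 y\<bar> \<le> b\<^sub>2"
      using kernel_bounded[OF \<phi>\<^sub>1 AE_law_support[OF dist_F], of "law_support G" "\<lambda>y. \<theta> * \<phi>\<^sub>2 y"] False pos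
      by (auto simp: mult_ac)
    obtain b\<^sub>1 where b\<^sub>1: "b\<^sub>1 \<ge> 0" "\<And>u. u \<in> law_support F \<Longrightarrow> \<bar>\<theta> * \<phi>\<^sub>1 u\<bar> \<le> b\<^sub>1"
      using kernel_bounded[OF \<phi>\<^sub>2 AE_law_support[OF G], of "law_support F" "\<lambda>u. \<theta> * \<phi>\<^sub>1 u"] False pos
      by (auto simp: mult_ac)
    define B where "B = 1 + b\<^sub>1 * (b\<^sub>2 / \<bar>\<theta>\<bar>)"
    have abs_\<phi>\<^sub>2: "\<bar>\<phi>\<^sub>2 y\<bar> \<le> b\<^sub>2 / \<bar>\<theta>\<bar>" if "y \<in> law_support G" for y
      using b\<^sub>2(2)[OF that] \<theta> by (simp add: abs_mult field_simps)
    have q_le: "?q u y \<le> B" if "u \<in> law_support F" "y \<in> law_support G" for u y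
    proof -
      have "\<bar>\<theta> * \<phi>\<^sub>1 u\<bar> * \<bar>\<phi>\<^sub>2 y\<bar> \<le> b\<^sub>1 * (b\<^sub>2 / \<bar>\<theta>\<bar>)"
        using that b\<^sub>1 abs_\<phi>\<^sub>2 by (intro mult_mono) auto
      then show ?thesis unfolding B_def abs_mult[symmetric] by (simp add: abs_le_iff)
    qed
    have \<phi>\<^sub>2_moment: "integrable G (\<lambda>y. \<phi>\<^sub>2 y * y powr \<alpha>)"
    proof (rule Bochner_Integration.integrable_bound)
      show "integrable G (\<lambda>y. b\<^sub>2 / \<bar>\<theta>\<bar> * y powr \<alpha>)" using moment by simp
      show "AE y in G. norm (\<phi>\<^sub>2 y * y powr \<alpha>) \<le> norm (b\<^sub>2 / \<bar>\<theta>\<bar> * y powr \<alpha>)"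
        using AE_law_support[OF G]
      proof eventually_elim
        case (elim y)
        have "\<bar>\<phi>\<^sub>2 y\<bar> * y powr \<alpha> \<le> b\<^sub>2 / \<bar>\<theta>\<bar> * y powr \<alpha>"
          by (intro mult_right_mono abs_\<phi>\<^sub>2 elim) auto
        then show ?case using b\<^sub>2(1) by (simp add: abs_mult)
      qed
    qed simp
    show ?thesis
    proof (rule that[of ?q "\<lambda>y. 1 + \<theta> * d\<^sub>1 * \<phi>\<^sub>2 y" B])
      have "AE y in G. AE u in F. 0 \<le> ?q u y \<and> ?q u y \<le> B"
        using AE_law_support[OF G]
      proof eventually_elim
        case y: (elim y)
        show ?case using AE_law_support[OF dist_F]
          by eventually_elim (use y pos q_le in auto)
      qed
      moreover have "(\<integral>u. ?q u y \<partial>F) = 1" for y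
        using \<phi>\<^sub>1 by (simp add: mass_1 mult_ac)
      moreover have "((\<lambda>u. ?q u y) \<longlongrightarrow> 1 + \<theta> * d\<^sub>1 * \<phi>\<^sub>2 y) at_top" for y
        by (intro tendsto_intros lim)
      moreover have "B \<ge> 0" using b\<^sub>1(1) b\<^sub>2(1) by (simp add: B_def)
      ultimately show "kernel_domination F G ?q (\<lambda>y. 1 + \<theta> * d\<^sub>1 * \<phi>\<^sub>2 y) B"
        by (simp add: kernel_domination_def)
      fix c
      have "(\<integral>y. (1 + \<theta> * d\<^sub>1 * \<phi>\<^sub>2 y + c) * y powr \<alpha> \<partial>G) =
        (\<integral>y. y powr \<alpha> + \<theta> * d\<^sub>1 * (\<phi>\<^sub>2 y * y powr \<alpha>) + c * y powr \<alpha> \<partial>G)"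
        by (simp add: algebra_simps)
      also have "\<dots> = (\<integral>y. y powr \<alpha> \<partial>G) + \<theta> * d\<^sub>1 * (\<integral>y. \<phi>\<^sub>2 y * y powr \<alpha> \<partial>G) + c * (\<integral>y. y powr \<alpha> \<partial>G)"
        using moment \<phi>\<^sub>2_moment by simp
      finally show "(\<integral>y. (1 + \<theta> * d\<^sub>1 * \<phi>\<^sub>2 y + c) * y powr \<alpha> \<partial>G) =
        (\<integral>y. y powr \<alpha> \<partial>G) + \<theta> * d\<^sub>1 * (\<integral>y. \<phi>\<^sub>2 y * y powr \<alpha> \<partial>G) + c * (\<integral>y. y powr \<alpha> \<partial>G)" .
    qed simp
  qed
qed

end

section \<open>The recursion for the maximum\<close>

text \<open>If all \<open>Y\<^sub>i\<close> are nonnegative, this is the positive part of the maximum of the discounted partial sums of the \<open>n\<close> pairs \<open>(X\<^sub>i, Y\<^sub>i) = f i\<close> with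
\<open>k \<le> i < k + n\<close>, in the form of the recursion that pulls out the first factor. Starting at a variable index \<open>k\<close> lets the
recursion refer to the later pairs themselves instead of to independent copies.\<close>
primrec discounted_max :: "nat \<Rightarrow> (nat \<Rightarrow> real \<times> real) \<Rightarrow> nat \<Rightarrow> real" where
  "discounted_max 0 f k = 0"
| "discounted_max (Suc n) f k = max 0 (snd (f k) * (fst (f k) + discounted_max n f (Suc k)))"

lemma discounted_max_nonneg: "0 \<le> discounted_max n f k"
  by (cases n) auto

lemma discounted_max_measurable:
  assumes "{k..<k + n} \<subseteq> I"
  shows "(\<lambda>f. discounted_max n f k) \<in> borel_measurable (Pi\<^sub>M I (\<lambda>_. borel \<Otimes>\<^sub>M borel))"
  using assms
proof (induction n arbitrary: k)
  case (Suc n)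
  then have "k \<in> I" by auto
  then have [measurable]: "(\<lambda>f. f k) \<in> Pi\<^sub>M I (\<lambda>_. borel \<Otimes>\<^sub>M borel) \<rightarrow>\<^sub>M borel \<Otimes>\<^sub>M (borel :: real measure)"
    by (rule measurable_component_singleton)
  have [measurable]: "(\<lambda>f. discounted_max n f (Suc k)) \<in> borel_measurable (Pi\<^sub>M I (\<lambda>_. borel \<Otimes>\<^sub>M borel))"
    using Suc.prems by (intro Suc.IH) auto
  show ?case unfolding discounted_max.simps by measurable
qed simp

lemma discounted_max_cong:
  assumes "\<And>i. i \<ge> k \<Longrightarrow> f i = g i"
  shows "discounted_max n f k = discounted_max n g k"
  using assms by (induction n arbitrary: k) auto

text \<open>The equivalence of levels \<open>x < y (a + t) \<longleftrightarrow> x / y - a < t\<close> reduces \<open>n + 1\<close> pairs to \<open>n\<close>. The new level may be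
negative, in which case it is exceeded by the nonnegative maximum; on the other side this is the event that the
first partial sum alone exceeds \<open>x\<close>.\<close>
lemma less_discounted_max_iff:
  assumes "\<And>i. i \<ge> k \<Longrightarrow> snd (f i) \<ge> 0" "x \<ge> 0"
  shows "x < discounted_max n f k \<longleftrightarrow> (\<exists>j\<in>{k..<k + n}. x < (\<Sum>i=k..j. fst (f i) * (\<Prod>l=k..i. snd (f l))))"
  using assms
proof (induction n arbitrary: k x)
  case (Suc n)
  let ?S = "\<lambda>k j. \<Sum>i=k..j. fst (f i) * (\<Prod>l=k..i. snd (f l))"
  have y: "snd (f k) \<ge> 0" using Suc.prems by simp
  have S_rec: "?S k j = snd (f k) * (fst (f k) + ?S (Suc k) j)" if "k \<le> j" for j
  proof -
    have "?S k j = fst (f k) * snd (f k) + (\<Sum>i=Suc k..j. fst (f i) * (\<Prod>l=k..i. snd (f l)))"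
      using that by (subst sum.atLeast_Suc_atMost) auto
    also have "(\<Sum>i=Suc k..j. fst (f i) * (\<Prod>l=k..i. snd (f l))) = snd (f k) * ?S (Suc k) j"
      unfolding sum_distrib_left by (rule sum.cong) (auto simp: prod.atLeast_Suc_atMost[of k])
    finally show ?thesis by (simp add: algebra_simps)
  qed
  have range: "{k..<k + Suc n} = insert k {Suc k..<Suc k + n}" by auto
  show ?case
  proof (cases "snd (f k) = 0")
    case True
    have "?S k j = 0" if "j \<in> {k..<k + Suc n}" for j using S_rec[of j] that True by simp
    then show ?thesis using True Suc.prems(2) by auto
  next
    case False
    with y have y: "snd (f k) > 0" by simp
    define x' where "x' = x / snd (f k) - fst (f k)"
    have shift: "x < snd (f k) * (fst (f k) + t) \<longleftrightarrow> x' < t" for t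
      using y by (auto simp: x'_def field_simps)
    have "x < discounted_max (Suc n) f k \<longleftrightarrow> x' < discounted_max n f (Suc k)"
      using Suc.prems(2) by (simp add: shift less_max_iff_disj)
    also have "\<dots> \<longleftrightarrow> x' < 0 \<or> (\<exists>j\<in>{Suc k..<Suc k + n}. x' < ?S (Suc k) j)"
    proof (cases "x' < 0")
      case True
      then show ?thesis using discounted_max_nonneg[of n f "Suc k"] by (auto intro: less_le_trans)
    next
      case False
      then show ?thesis using Suc.prems(1) by (subst Suc.IH) auto
    qed
    also have "\<dots> \<longleftrightarrow> (\<exists>j\<in>{k..<k + Suc n}. x < ?S k j)"
    proof -
      have "x < ?S k k \<longleftrightarrow> x' < 0" using shift[of 0] by (simp add: mult.commute)
      moreover have "x < ?S k j \<longleftrightarrow> x' < ?S (Suc k) j" if "j \<in> {Suc k..<Suc k + n}" for j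
        using shift S_rec[of j] that by simp
      ultimately show ?thesis unfolding range by blast
    qed
    finally show ?thesis .
  qed
qed simp

lemma geom_factor_Suc: "geom_factor e (Suc n) = 1 + e * geom_factor e n"
  by (auto simp: geom_factor_def field_simps)

lemma equiv_const_mult_if_ratio_limit:
  assumes "((\<lambda>x. a x / b x) \<longlongrightarrow> C) at_top" "\<And>x. b x \<noteq> 0"
  shows "equiv_const_mult a C b"
proof (cases "C = 0")
  case True
  then show ?thesis using assms by (auto simp: equiv_const_mult_def intro!: smalloI_tendsto always_eventually)
next
  case False
  have "((\<lambda>x. a x / b x / C) \<longlongrightarrow> C / C) at_top"
    by (intro tendsto_intros assms False)
  then show ?thesis using False by (simp add: equiv_const_mult_def tail_equiv_def mult.commute)
qed

lemma (in prob_space) ruin_prob_eq_discounted_max: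
  assumes meas: "\<And>i. i \<ge> 1 \<Longrightarrow> X i \<in> borel_measurable M" "\<And>i. i \<ge> 1 \<Longrightarrow> Y i \<in> borel_measurable M"
    and nonneg: "\<And>i. i \<ge> 1 \<Longrightarrow> AE \<omega> in M. Y i \<omega> \<ge> 0"
    and "n \<ge> 1" "x \<ge> 0"
    and W: "(\<lambda>\<omega>. discounted_max n (\<lambda>i. (X i \<omega>, Y i \<omega>)) 1) \<in> borel_measurable M"
  shows "ruin_prob M X Y x n = prob {\<omega> \<in> space M. x < discounted_max n (\<lambda>i. (X i \<omega>, Y i \<omega>)) 1}"
  unfolding ruin_prob_def
proof (rule measure_eq_AE)
  let ?S = "\<lambda>k \<omega>. \<Sum>i=1..k. X i \<omega> * (\<Prod>j=1..i. Y j \<omega>)"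
  have Max_iff: "(MAX k\<in>{1..n}. ?S k \<omega>) > x \<longleftrightarrow> (\<exists>k\<in>{1..n}. x < ?S k \<omega>)" for \<omega>
    using \<open>n \<ge> 1\<close> by (subst Max_gr_iff) auto
  have "AE \<omega> in M. \<forall>i\<in>{1..}. Y i \<omega> \<ge> 0"
    using nonneg by (simp add: AE_ball_countable)
  then show "AE \<omega> in M. \<omega> \<in> {\<omega> \<in> space M. (MAX k\<in>{1..n}. ?S k \<omega>) > x} \<longleftrightarrow>
      \<omega> \<in> {\<omega> \<in> space M. x < discounted_max n (\<lambda>i. (X i \<omega>, Y i \<omega>)) 1}"
  proof eventually_elim
    case (elim \<omega>)
    have "x < discounted_max n (\<lambda>i. (X i \<omega>, Y i \<omega>)) 1 \<longleftrightarrow> (\<exists>j\<in>{1..<1 + n}. x < ?S j \<omega>)"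
      using elim \<open>x \<ge> 0\<close> by (subst less_discounted_max_iff) auto
    also have "{1..<1 + n} = {1..n}" by auto
    finally show ?case by (simp only: Max_iff mem_Collect_eq)
  qed
  have "?S k \<in> borel_measurable M" for k
    using meas by (intro borel_measurable_sum borel_measurable_times borel_measurable_prod) auto
  then have "{\<omega> \<in> space M. x < ?S k \<omega>} \<in> sets M" for k
    by (intro borel_measurable_less) auto
  then have "(\<Union>k\<in>{1..n}. {\<omega> \<in> space M. x < ?S k \<omega>}) \<in> sets M"
    by (intro sets.finite_UN) auto
  also have "(\<Union>k\<in>{1..n}. {\<omega> \<in> space M. x < ?S k \<omega>}) = {\<omega> \<in> space M. (MAX k\<in>{1..n}. ?S k \<omega>) > x}"
    unfolding Max_iff by auto
  finally show "{\<omega> \<in> space M. (MAX k\<in>{1..n}. ?S k \<omega>) > x} \<in> sets M" .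
  show "{\<omega> \<in> space M. x < discounted_max n (\<lambda>i. (X i \<omega>, Y i \<omega>)) 1} \<in> sets M"
    using W by measurable
qed

text \<open>Independence holds between the coordinate \<open>k\<close> and the family of the later coordinates, both viewed as elements of
product spaces; it is transported to the variables of interest by pushing forward the product law.\<close>
lemma (in prob_space) joint_law_discounted_max:
  assumes "indep_vars (\<lambda>_. borel \<Otimes>\<^sub>M borel) (\<lambda>i \<omega>. (X i \<omega>, Y i \<omega>)) {1..}" "k \<ge> (1::nat)"
  shows "(\<lambda>\<omega>. (X k \<omega>, Y k \<omega>)) \<in> M \<rightarrow>\<^sub>M borel \<Otimes>\<^sub>M borel"
    and "(\<lambda>\<omega>. discounted_max n (\<lambda>i. (X i \<omega>, Y i \<omega>)) (Suc k)) \<in> borel_measurable M"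
    and "distr M ((borel \<Otimes>\<^sub>M borel) \<Otimes>\<^sub>M borel)
        (\<lambda>\<omega>. ((X k \<omega>, Y k \<omega>), discounted_max n (\<lambda>i. (X i \<omega>, Y i \<omega>)) (Suc k))) =
      distr M (borel \<Otimes>\<^sub>M borel) (\<lambda>\<omega>. (X k \<omega>, Y k \<omega>)) \<Otimes>\<^sub>M
      distr M borel (\<lambda>\<omega>. discounted_max n (\<lambda>i. (X i \<omega>, Y i \<omega>)) (Suc k))"
proof -
  let ?Z = "\<lambda>\<omega> i. (X i \<omega> :: real, Y i \<omega> :: real)"
  let ?S = "Pi\<^sub>M {k} (\<lambda>_. borel \<Otimes>\<^sub>M borel) :: (nat \<Rightarrow> real \<times> real) measure"
  let ?T = "Pi\<^sub>M {Suc k..} (\<lambda>_. borel \<Otimes>\<^sub>M borel) :: (nat \<Rightarrow> real \<times> real) measure"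
  let ?A = "\<lambda>\<omega>. restrict (?Z \<omega>) {k}" and ?B = "\<lambda>\<omega>. restrict (?Z \<omega>) {Suc k..}"
  let ?f = "\<lambda>f. f k" and ?g = "\<lambda>f. discounted_max n f (Suc k)"
  have "indep_var ?S ?A ?T ?B"
    by (rule indep_var_restrict[OF assms(1)]) (use \<open>k \<ge> 1\<close> in auto)
  then have A[measurable]: "?A \<in> M \<rightarrow>\<^sub>M ?S" and B[measurable]: "?B \<in> M \<rightarrow>\<^sub>M ?T"
    and AB: "distr M (?S \<Otimes>\<^sub>M ?T) (\<lambda>\<omega>. (?A \<omega>, ?B \<omega>)) = distr M ?S ?A \<Otimes>\<^sub>M distr M ?T ?B"
    unfolding indep_var_distribution_eq by auto
  have f[measurable]: "?f \<in> ?S \<rightarrow>\<^sub>M borel \<Otimes>\<^sub>M borel"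
    by (rule measurable_component_singleton) simp
  have g[measurable]: "?g \<in> borel_measurable ?T"
    by (rule discounted_max_measurable) auto
  have gB: "?g (?B \<omega>) = ?g (?Z \<omega>)" for \<omega>
    by (rule discounted_max_cong) simp
  show Z_meas: "(\<lambda>\<omega>. ?Z \<omega> k) \<in> M \<rightarrow>\<^sub>M borel \<Otimes>\<^sub>M borel"
    using measurable_compose[OF A f] by simp
  show W_meas: "(\<lambda>\<omega>. ?g (?Z \<omega>)) \<in> borel_measurable M"
    using measurable_compose[OF B g] by (simp add: gB)
  have law_Z: "distr M (borel \<Otimes>\<^sub>M borel) (\<lambda>\<omega>. ?Z \<omega> k) = distr (distr M ?S ?A) (borel \<Otimes>\<^sub>M borel) ?f"
    by (subst distr_distr[OF f A]) (simp add: comp_def)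
  have law_W: "distr M borel (\<lambda>\<omega>. ?g (?Z \<omega>)) = distr (distr M ?T ?B) borel ?g"
    by (subst distr_distr[OF g B]) (simp add: comp_def gB)
  have "prob_space (distr (distr M ?T ?B) borel ?g)"
    unfolding law_W[symmetric] by (rule prob_space_distr[OF W_meas])
  then have "sigma_finite_measure (distr (distr M ?T ?B) borel ?g)"
    by (rule prob_space_imp_sigma_finite)
  then have "distr M (borel \<Otimes>\<^sub>M borel) (\<lambda>\<omega>. ?Z \<omega> k) \<Otimes>\<^sub>M distr M borel (\<lambda>\<omega>. ?g (?Z \<omega>)) =
      distr (distr M ?S ?A \<Otimes>\<^sub>M distr M ?T ?B) ((borel \<Otimes>\<^sub>M borel) \<Otimes>\<^sub>M borel) (\<lambda>(x, y). (?f x, ?g y))"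
    unfolding law_Z law_W by (intro pair_measure_distr) simp_all
  also have "\<dots> = distr M ((borel \<Otimes>\<^sub>M borel) \<Otimes>\<^sub>M borel) (\<lambda>\<omega>. (?Z \<omega> k, ?g (?Z \<omega>)))"
    unfolding AB[symmetric] by (subst distr_distr) (auto simp: comp_def gB)
  finally show "distr M ((borel \<Otimes>\<^sub>M borel) \<Otimes>\<^sub>M borel) (\<lambda>\<omega>. (?Z \<omega> k, ?g (?Z \<omega>))) =
      distr M (borel \<Otimes>\<^sub>M borel) (\<lambda>\<omega>. ?Z \<omega> k) \<Otimes>\<^sub>M distr M borel (\<lambda>\<omega>. ?g (?Z \<omega>))" ..
qed

text \<open>One step sends the limit \<open>c\<close> to \<open>a + c E[Y\<^sup>\<alpha>]\<close>, which is also the recursion of the geometric sums. The induction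
must range over all starting indices \<open>k\<close>, as the step from \<open>n\<close> to \<open>n + 1\<close> looks at the pairs after \<open>k\<close>.\<close>
lemma (in prob_space) discounted_max_tail_limit:
  assumes rv: "regularly_varying F \<alpha>" and G: "real_distribution G"
    and neg: "large_factor_negligible F G"
    and moment: "integrable G (\<lambda>y. y powr \<alpha>)" and nonneg: "AE y in G. y \<ge> 0"
    and kernel: "kernel_domination F G q r B"
    and indep: "indep_vars (\<lambda>_. borel \<Otimes>\<^sub>M borel) (\<lambda>i \<omega>. (X i \<omega>, Y i \<omega>)) {1..}"
    and law: "\<And>i. i \<ge> (1::nat) \<Longrightarrow> distr M (borel \<Otimes>\<^sub>M borel) (\<lambda>\<omega>. (X i \<omega>, Y i \<omega>)) =
      density (F \<Otimes>\<^sub>M G) (\<lambda>(u, y). ennreal (q u y))"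
    and a: "\<And>c. (\<integral>y. (r y + c) * y powr \<alpha> \<partial>G) = a + c * (\<integral>y. y powr \<alpha> \<partial>G)"
    and "k \<ge> 1"
  shows "((\<lambda>x. prob {\<omega> \<in> space M. x < discounted_max n (\<lambda>i. (X i \<omega>, Y i \<omega>)) k} / tail F x)
    \<longlongrightarrow> geom_factor (\<integral>y. y powr \<alpha> \<partial>G) n * a) at_top"
  using \<open>k \<ge> 1\<close>
proof (induction n arbitrary: k)
  case 0
  have "\<forall>\<^sub>F x in at_top. prob {\<omega> \<in> space M. x < discounted_max 0 (\<lambda>i. (X i \<omega>, Y i \<omega>)) k} / tail F x = 0"
    using eventually_ge_at_top[of 0] by eventually_elim (auto simp: not_less)
  then show ?case by (simp add: geom_factor_def tendsto_eventually)
next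
  case (Suc n)
  interpret F: regularly_varying F \<alpha> by fact
  let ?e = "\<integral>y. y powr \<alpha> \<partial>G"
  let ?D = "density (F \<Otimes>\<^sub>M G) (\<lambda>(u, y). ennreal (q u y))"
  let ?Z = "\<lambda>\<omega>. (X k \<omega>, Y k \<omega>)"
  let ?W = "\<lambda>\<omega>. discounted_max n (\<lambda>i. (X i \<omega>, Y i \<omega>)) (Suc k)"
  define N where "N = distr M borel ?W"
  note indep_ZW = joint_law_discounted_max(1)[OF indep \<open>1 \<le> k\<close>]
    joint_law_discounted_max(2,3)[OF indep \<open>1 \<le> k\<close>, of n]
  have Z_meas[measurable]: "?Z \<in> M \<rightarrow>\<^sub>M borel \<Otimes>\<^sub>M borel" and W_meas[measurable]: "?W \<in> borel_measurable M"
    by (rule indep_ZW)+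
  have N: "real_distribution N"
    unfolding N_def by (rule real_distribution_distr) simp
  have "tail N x = prob {\<omega> \<in> space M. x < ?W \<omega>}" for x
    unfolding tail_def N_def by (subst measure_distr) (auto intro!: arg_cong2[where f = measure])
  then have N_lim: "((\<lambda>x. tail N x / tail F x) \<longlongrightarrow> geom_factor ?e n * a) at_top"
    using Suc.IH[of "Suc k"] by simp
  have joint: "distr M ((borel \<Otimes>\<^sub>M borel) \<Otimes>\<^sub>M borel) (\<lambda>\<omega>. (?Z \<omega>, ?W \<omega>)) = ?D \<Otimes>\<^sub>M N"
    using indep_ZW(3) law[OF \<open>1 \<le> k\<close>] unfolding N_def by simp
  let ?S = "\<lambda>x. {p. x < snd (fst p) * (fst (fst p) + snd p)}"
  have "\<forall>\<^sub>F x in at_top. measure (?D \<Otimes>\<^sub>M N) (?S x) / tail F x =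
      prob {\<omega> \<in> space M. x < discounted_max (Suc n) (\<lambda>i. (X i \<omega>, Y i \<omega>)) k} / tail F x"
    using eventually_ge_at_top[of 0]
  proof eventually_elim
    case (elim x)
    have "{p \<in> space ((borel \<Otimes>\<^sub>M borel) \<Otimes>\<^sub>M borel). x < snd (fst p) * (fst (fst p) + snd p)} \<in> sets ((borel \<Otimes>\<^sub>M borel) \<Otimes>\<^sub>M borel)"
      by measurable
    then have "?S x \<in> sets ((borel \<Otimes>\<^sub>M borel) \<Otimes>\<^sub>M borel)" by (simp add: space_pair_measure)
    then have "measure (?D \<Otimes>\<^sub>M N) (?S x) = prob ((\<lambda>\<omega>. (?Z \<omega>, ?W \<omega>)) -` ?S x \<inter> space M)"
      unfolding joint[symmetric] by (intro measure_distr) auto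
    also have "(\<lambda>\<omega>. (?Z \<omega>, ?W \<omega>)) -` ?S x \<inter> space M =
        {\<omega> \<in> space M. x < discounted_max (Suc n) (\<lambda>i. (X i \<omega>, Y i \<omega>)) k}"
      using elim by (auto simp: less_max_iff_disj)
    finally show ?case by simp
  qed
  moreover have "((\<lambda>x. measure (?D \<Otimes>\<^sub>M N) (?S x) / tail F x) \<longlongrightarrow> (\<integral>y. (r y + geom_factor ?e n * a) * y powr \<alpha> \<partial>G)) at_top"
    using kernel unfolding kernel_domination_def
    by (intro F.randomly_discounted_sum_tail[OF G N neg moment nonneg _ _ _ _ _ _ N_lim, of q r B]) auto
  ultimately have "((\<lambda>x. prob {\<omega> \<in> space M. x < discounted_max (Suc n) (\<lambda>i. (X i \<omega>, Y i \<omega>)) k} / tail F x)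
      \<longlongrightarrow> (\<integral>y. (r y + geom_factor ?e n * a) * y powr \<alpha> \<partial>G)) at_top"
    by (rule Lim_transform_eventually[rotated])
  also have "(\<integral>y. (r y + geom_factor ?e n * a) * y powr \<alpha> \<partial>G) = geom_factor ?e (Suc n) * a"
    unfolding a by (simp add: geom_factor_Suc algebra_simps)
  finally show ?case .
qed

section \<open>Asymptotics of the ruin probability\<close>

theorem theorem3p3:
  fixes M :: "'a measure"
    and X Y :: "nat \<Rightarrow> 'a \<Rightarrow> real"
    and X\<^sub>0 Y\<^sub>0 :: "'a \<Rightarrow> real"
    and F G :: "real measure"
    and \<phi>\<^sub>1 \<phi>\<^sub>2 :: "real \<Rightarrow> real"
    and \<theta> \<alpha> d\<^sub>1 :: real
    and n :: nat
  assumes "prob_space M"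
    and "\<alpha> > 0"
    and "prob_space.indep_vars M (\<lambda>_. borel \<Otimes>\<^sub>M borel) (\<lambda>i \<omega>. (X i \<omega>, Y i \<omega>)) {1..}"
    and "\<And>i. i \<ge> 1 \<Longrightarrow>
           distr M (borel \<Otimes>\<^sub>M borel) (\<lambda>\<omega>. (X i \<omega>, Y i \<omega>)) =
           distr M (borel \<Otimes>\<^sub>M borel) (\<lambda>\<omega>. (X\<^sub>0 \<omega>, Y\<^sub>0 \<omega>))"
    and "sarmanov M X\<^sub>0 Y\<^sub>0 F G \<phi>\<^sub>1 \<phi>\<^sub>2 \<theta>"
    and "regularly_varying_tail \<alpha> F"
    and "integrable M (\<lambda>\<omega>. Y\<^sub>0 \<omega> powr \<alpha>)"
    and "tail G \<in> o[at_top](tail F)"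
    and "(\<phi>\<^sub>1 \<longlongrightarrow> d\<^sub>1) at_top"
    and "DZ2 \<alpha> F \<or> DZ3 \<alpha> F G \<or> DZ4 \<alpha> F G"
    and "n \<ge> 1"
  shows "equiv_const_mult
           (\<lambda>x. ruin_prob M X Y x n)
           (geom_factor (\<integral>\<omega>. Y\<^sub>0 \<omega> powr \<alpha> \<partial>M) n *
             ((\<integral>\<omega>. Y\<^sub>0 \<omega> powr \<alpha> \<partial>M) + \<theta> * d\<^sub>1 * (\<integral>\<omega>. \<phi>\<^sub>2 (Y\<^sub>0 \<omega>) * Y\<^sub>0 \<omega> powr \<alpha> \<partial>M)))
           (tail F)"
proof -
  interpret prob_space M by fact
  have X0[measurable]: "X\<^sub>0 \<in> borel_measurable M" and Y0[measurable]: "Y\<^sub>0 \<in> borel_measurable M"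
    and Y0_nonneg: "AE \<omega> in M. Y\<^sub>0 \<omega> \<ge> 0"
    and F_eq: "F = distr M borel X\<^sub>0" and G_eq: "G = distr M borel Y\<^sub>0"
    and \<phi>_meas[measurable]: "\<phi>\<^sub>1 \<in> borel_measurable borel" "\<phi>\<^sub>2 \<in> borel_measurable borel"
    and \<phi>\<^sub>1: "integrable M (\<lambda>\<omega>. \<phi>\<^sub>1 (X\<^sub>0 \<omega>))" "(\<integral>\<omega>. \<phi>\<^sub>1 (X\<^sub>0 \<omega>) \<partial>M) = 0"
    and \<phi>\<^sub>2: "integrable M (\<lambda>\<omega>. \<phi>\<^sub>2 (Y\<^sub>0 \<omega>))" "(\<integral>\<omega>. \<phi>\<^sub>2 (Y\<^sub>0 \<omega>) \<partial>M) = 0"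
    and pos: "\<forall>x\<in>law_support F. \<forall>y\<in>law_support G. 1 + \<theta> * \<phi>\<^sub>1 x * \<phi>\<^sub>2 y \<ge> 0"
    and joint: "distr M (borel \<Otimes>\<^sub>M borel) (\<lambda>\<omega>. (X\<^sub>0 \<omega>, Y\<^sub>0 \<omega>)) =
       density (F \<Otimes>\<^sub>M G) (\<lambda>(x, y). ennreal (1 + \<theta> * \<phi>\<^sub>1 x * \<phi>\<^sub>2 y))"
    using \<open>sarmanov M X\<^sub>0 Y\<^sub>0 F G \<phi>\<^sub>1 \<phi>\<^sub>2 \<theta>\<close> unfolding sarmanov_def by blast+
  have F: "real_distribution F" and G: "real_distribution G"
    unfolding F_eq G_eq by (intro real_distribution_distr; simp)+
  interpret F: regularly_varying F \<alpha>
    using F \<open>\<alpha> > 0\<close> \<open>regularly_varying_tail \<alpha> F\<close>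
    by (simp add: regularly_varying_def regularly_varying_axioms_def)
  have moment: "integrable G (\<lambda>y. y powr \<alpha>)"
    using assms(7) unfolding G_eq by (subst integrable_distr_eq) auto
  have neg: "large_factor_negligible F G"
    using assms(10) F.DZ2_imp_negligible[OF G assms(8)] F.DZ3_imp_negligible[OF G assms(8)]
      F.DZ4_imp_negligible[OF G assms(8) moment] by blast
  have nonneg: "AE y in G. y \<ge> 0"
    unfolding G_eq using Y0_nonneg by (subst AE_distr_iff) auto
  have \<phi>\<^sub>1': "integrable F \<phi>\<^sub>1" "(\<integral>u. \<phi>\<^sub>1 u \<partial>F) = 0"
    using \<phi>\<^sub>1 unfolding F_eq by (simp_all add: integrable_distr_eq integral_distr)
  have \<phi>\<^sub>2': "integrable G \<phi>\<^sub>2" "(\<integral>y. \<phi>\<^sub>2 y \<partial>G) = 0"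
    using \<phi>\<^sub>2 unfolding G_eq by (simp_all add: integrable_distr_eq integral_distr)
  obtain q r B where kernel: "kernel_domination F G q r B"
    and density: "density (F \<Otimes>\<^sub>M G) (\<lambda>(u, y). ennreal (1 + \<theta> * \<phi>\<^sub>1 u * \<phi>\<^sub>2 y)) = density (F \<Otimes>\<^sub>M G) (\<lambda>(u, y). ennreal (q u y))"
    and r: "\<And>c. (\<integral>y. (r y + c) * y powr \<alpha> \<partial>G) =
      (\<integral>y. y powr \<alpha> \<partial>G) + \<theta> * d\<^sub>1 * (\<integral>y. \<phi>\<^sub>2 y * y powr \<alpha> \<partial>G) + c * (\<integral>y. y powr \<alpha> \<partial>G)"
    by (rule F.sarmanov_kernel[OF G \<phi>_meas \<phi>\<^sub>1' \<phi>\<^sub>2' pos \<open>(\<phi>\<^sub>1 \<longlongrightarrow> d\<^sub>1) at_top\<close> moment]) (rule that)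
  have law: "distr M (borel \<Otimes>\<^sub>M borel) (\<lambda>\<omega>. (X i \<omega>, Y i \<omega>)) = density (F \<Otimes>\<^sub>M G) (\<lambda>(u, y). ennreal (q u y))"
    if "i \<ge> 1" for i
    using assms(4)[OF that] joint density by simp
  let ?W = "\<lambda>\<omega>. discounted_max n (\<lambda>i. (X i \<omega>, Y i \<omega>)) 1"
  let ?a = "(\<integral>y. y powr \<alpha> \<partial>G) + \<theta> * d\<^sub>1 * (\<integral>y. \<phi>\<^sub>2 y * y powr \<alpha> \<partial>G)"
  have W_lim: "((\<lambda>x. prob {\<omega> \<in> space M. x < ?W \<omega>} / tail F x) \<longlongrightarrow> geom_factor (\<integral>y. y powr \<alpha> \<partial>G) n * ?a) at_top"
    by (rule discounted_max_tail_limit[OF F.regularly_varying_axioms G neg moment nonneg kernel assms(3) law]) (simp_all add: r)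
  have pair: "(\<lambda>\<omega>. (X i \<omega>, Y i \<omega>)) \<in> M \<rightarrow>\<^sub>M borel \<Otimes>\<^sub>M borel" if "i \<ge> 1" for i
    using assms(3) that unfolding indep_vars_def by auto
  have meas: "X i \<in> borel_measurable M" "Y i \<in> borel_measurable M" if "i \<ge> 1" for i
    using measurable_compose[OF pair[OF that] measurable_fst] measurable_compose[OF pair[OF that] measurable_snd] by simp_all
  have Y_nonneg: "AE \<omega> in M. Y i \<omega> \<ge> 0" if "i \<ge> 1" for i
  proof -
    have "AE p in distr M (borel \<Otimes>\<^sub>M borel) (\<lambda>\<omega>. (X\<^sub>0 \<omega>, Y\<^sub>0 \<omega>)). snd p \<ge> 0"
      using Y0_nonneg by (subst AE_distr_iff) auto
    then show ?thesis
      unfolding assms(4)[OF that, symmetric] using pair[OF that] by (subst (asm) AE_distr_iff) auto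
  qed
  have W_meas: "?W \<in> borel_measurable M"
  proof -
    have "(\<lambda>\<omega>. \<lambda>i\<in>{1..}. (X i \<omega>, Y i \<omega>)) \<in> M \<rightarrow>\<^sub>M Pi\<^sub>M {1..} (\<lambda>_. borel \<Otimes>\<^sub>M borel)"
      using pair by (intro measurable_restrict) auto
    moreover have "(\<lambda>f. discounted_max n f 1) \<in> borel_measurable (Pi\<^sub>M {1..} (\<lambda>_. borel \<Otimes>\<^sub>M borel))"
      by (rule discounted_max_measurable) auto
    ultimately have "(\<lambda>\<omega>. discounted_max n (\<lambda>i\<in>{1..}. (X i \<omega>, Y i \<omega>)) 1) \<in> borel_measurable M"
      by (rule measurable_compose)
    also have "(\<lambda>\<omega>. discounted_max n (\<lambda>i\<in>{1..}. (X i \<omega>, Y i \<omega>)) 1) = ?W"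
      by (intro ext discounted_max_cong) simp
    finally show ?thesis .
  qed
  have "\<forall>\<^sub>F x in at_top. prob {\<omega> \<in> space M. x < ?W \<omega>} / tail F x = ruin_prob M X Y x n / tail F x"
    using eventually_ge_at_top[of 0]
    by eventually_elim
       (simp add: ruin_prob_eq_discounted_max[OF meas Y_nonneg \<open>n \<ge> 1\<close> _ W_meas])
  with W_lim have "((\<lambda>x. ruin_prob M X Y x n / tail F x) \<longlongrightarrow> geom_factor (\<integral>y. y powr \<alpha> \<partial>G) n * ?a) at_top"
    by (rule Lim_transform_eventually)
  moreover have "(\<integral>y. y powr \<alpha> \<partial>G) = (\<integral>\<omega>. Y\<^sub>0 \<omega> powr \<alpha> \<partial>M)"
    "(\<integral>y. \<phi>\<^sub>2 y * y powr \<alpha> \<partial>G) = (\<integral>\<omega>. \<phi>\<^sub>2 (Y\<^sub>0 \<omega>) * Y\<^sub>0 \<omega> powr \<alpha> \<partial>M)"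
    unfolding G_eq by (simp_all add: integral_distr)
  ultimately show ?thesis
    using F.F_pos by (intro equiv_const_mult_if_ratio_limit) (auto simp: less_imp_neq[symmetric])
qed

end
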